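(* Let $\mathbb K$ be a number field that is Galois over $\mathbb Q$, let $r\ge1$ be an integer and let $A$ be a square matrix with entries in $\mathbb K[x_1^{\pm1},\dots,x_r^{\pm1}]$. Then the sequence $\big(\mathrm{cst}(\mathrm{Tr}(A^n))\big)_{n\ge0}$ has the Cartier property.
   Context: $\mathbb K[x_1^{\pm1},\dots,x_r^{\pm1}]$ is the (commutative) ring of Laurent polynomials; $\mathrm{cst}(\lambda)\in\mathbb K$ denotes the constant term of a Laurent polynomial $\lambda$; $\mathrm{Tr}$ is the trace. $\mathcal O_{\mathbb K}$ is the ring of integers of $\mathbb K$ and, for a non-zero prime ideal $\mathfrak p$, $\mathcal O_{\mathbb K,\mathfrak p}$ is the localization of $\mathcal O_{\mathbb K}$ at $\mathfrak p$. If $\mathfrak p$ is unramified and lies above the rational prime $p$, then $\tau_{\mathfrak p}\in\mathrm{Gal}(\mathbb K/\mathbb Q)$ denotes the Frobenius element associated with $\mathfrak p$, i.e. the unique automorphism with $\tau_{\mathfrak p}(x)\equiv x^p\bmod\mathfrak p$ for all $x\in\mathcal O_{\mathbb K}$. A sequence $(a_n)_{n\in\mathbb Z}$ of elements of $\mathbb K$ satisfies Cartier congruences for the unramified prime $\mathfrak p$ above $p$ if $a_{np}-\tau_{\mathfrak p}(a_n)\in p\,\mathcal O_{\mathbb K,\mathfrak p}$ for all $n\in\mathbb Z$; it has the Cartier property if this holds for all but finitely many primes $\mathfrak p$ of $\mathcal O_{\mathbb K}$. A sequence $(a_n)_{n\ge0}$ is extended by $a_n=0$ for $n<0$. *)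

theory Defs
  imports
    Complex_Main
    "HOL-Library.Poly_Mapping"
    "HOL-Library.Function_Algebras"
    "HOL-Computational_Algebra.Polynomial"
    "HOL-Computational_Algebra.Primes"
    "HOL-Algebra.Ideal_Product"
    "Jordan_Normal_Form.Matrix"
begin

section \<open>Number fields and Galois extensions of the rationals\<close>

text \<open>A field is represented by a type of class \<^class>\<open>field_char_0\<close>, so the field is the
  whole type. Every field homomorphism fixes the rationals, hence the automorphisms below are
  exactly the automorphisms over the rationals.\<close>

definition number_field :: "'k::field_char_0 itself \<Rightarrow> bool" where
  "number_field _ \<longleftrightarrow>
     (\<exists>B::'k set. finite B \<and> Modules.module.span (\<lambda>(q::rat) x. of_rat q * x) B = UNIV)"

definition galois_group :: "('k::field_char_0 \<Rightarrow> 'k) set" where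
  "galois_group = {\<sigma>. field_isom \<sigma>}"

definition galois_over_rationals :: "'k::field_char_0 itself \<Rightarrow> bool" where
  "galois_over_rationals _ \<longleftrightarrow> {x::'k. \<forall>\<sigma>\<in>galois_group. \<sigma> x = x} = \<rat>"

section \<open>The ring of integers and its primes\<close>

definition ring_of_integers :: "'k::field_char_0 ring" (\<open>\<O>\<close>) where
  "\<O> = \<lparr>carrier = {x. algebraic_int x}, monoid.mult = (*), one = 1, zero = 0, add = (+)\<rparr>"

definition nonzero_prime :: "'k::field_char_0 set \<Rightarrow> bool" where
  "nonzero_prime P \<longleftrightarrow> primeideal P \<O> \<and> P \<noteq> {0}"

text \<open>For a prime ideal \<open>P\<close>, containing the prime number \<open>p\<close> is the same as meeting the
  integers in the ideal generated by \<open>p\<close>.\<close>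

definition prime_below :: "'k::field_char_0 set \<Rightarrow> nat" where
  "prime_below P = (THE p. prime p \<and> of_nat p \<in> P)"

definition ramification_index :: "'k::field_char_0 set \<Rightarrow> nat" where
  "ramification_index P =
     (GREATEST e. PIdl\<^bsub>\<O>\<^esub> (of_nat (prime_below P)) \<subseteq> P [^]\<^bsub>ideals_set \<O>\<^esub> e)"

text \<open>The residue fields are finite, so there is no separability condition.\<close>

definition unramified :: "'k::field_char_0 set \<Rightarrow> bool" where
  "unramified P \<longleftrightarrow> ramification_index P = 1"

definition localization :: "'k::field_char_0 set \<Rightarrow> 'k set" where
  "localization P = {a / b | a b. a \<in> carrier \<O> \<and> b \<in> carrier \<O> - P}"

definition frobenius :: "'k::field_char_0 set \<Rightarrow> 'k \<Rightarrow> 'k" where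
  "frobenius P =
     (THE \<tau>. \<tau> \<in> galois_group \<and> (\<forall>x\<in>carrier \<O>. \<tau> x - x ^ prime_below P \<in> P))"

section \<open>Cartier congruences\<close>

definition cartier_congruences :: "(int \<Rightarrow> 'k::field_char_0) \<Rightarrow> 'k set \<Rightarrow> bool" where
  "cartier_congruences a P \<longleftrightarrow>
     (\<forall>n. a (n * int (prime_below P)) - frobenius P (a n)
            \<in> (\<lambda>x. of_nat (prime_below P) * x) ` localization P)"

text \<open>The congruences are meaningful only at unramified primes, so the ramified ones count among
  the exceptions.\<close>

definition cartier_property :: "(int \<Rightarrow> 'k::field_char_0) \<Rightarrow> bool" where
  "cartier_property a \<longleftrightarrow>
     finite {P. nonzero_prime P \<and> \<not> (unramified P \<and> cartier_congruences a P)}"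

definition extend_by_zero :: "(nat \<Rightarrow> 'k::zero) \<Rightarrow> int \<Rightarrow> 'k" where
  "extend_by_zero a n = (if n < 0 then 0 else a (nat n))"

section \<open>Laurent polynomials and matrices\<close>

text \<open>Finitely supported functions on the exponent vectors, multiplied by convolution; the
  variables are indexed by \<open>'r\<close>.\<close>

type_synonym ('r, 'k) laurent_poly = "('r \<Rightarrow> int) \<Rightarrow>\<^sub>0 'k"

definition cst :: "('r, 'k::zero) laurent_poly \<Rightarrow> 'k" where
  "cst f = Poly_Mapping.lookup f 0"

definition mat_trace :: "'a::comm_monoid_add mat \<Rightarrow> 'a" where
  "mat_trace A = (\<Sum>i<dim_row A. A $$ (i, i))"

end

theory Submission
  imports
    Defs
    "Jordan_Normal_Form.Char_Poly"
begin

text \<open>Put \<open>B = A\<^sup>n\<close>, so that \<open>A\<^bsup>np\<^esup> = B\<^sup>p\<close>. It must be shown that the constant term of \<open>Tr (B\<^sup>p)\<close> is congruent to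
\<open>\<tau> (cst (Tr B))\<close> modulo \<open>p\<close> in the localization at \<open>\<pp>\<close>, for almost all \<open>\<pp>\<close>.

The combinatorial half holds over every commutative ring. The trace of \<open>B\<^sup>p\<close> is the sum of the
weights of the closed walks of length \<open>p\<close>; rotation of walks is an action of the cyclic group of
prime order \<open>p\<close> that preserves the weights, so modulo \<open>p\<close> only the constant walks survive
and \<open>Tr (B\<^sup>p) \<equiv> \<Sum>i. B\<^sub>i\<^sub>i\<^sup>p\<close>. The same argument on words instead of walks gives
\<open>(\<Sum>i. f\<^sub>i)\<^sup>p \<equiv> \<Sum>i. f\<^sub>i\<^sup>p\<close>; applied to the monomials of a Laurent polynomial \<open>f\<close> it
yields \<open>cst (f\<^sup>p) \<equiv> (cst f)\<^sup>p\<close>, because \<open>p \<cdot> v = 0\<close> forces \<open>v = 0\<close>. Hence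
\<open>cst (Tr (B\<^sup>p)) \<equiv> \<Sum>i. (cst B\<^sub>i\<^sub>i)\<^sup>p\<close> (\<open>cst_trace_power_cong\<close>). If the coefficients of \<open>A\<close> lie in the
localization, it remains to know that \<open>x\<^sup>p \<equiv> \<tau> x\<close> modulo \<open>p\<close> there.

The arithmetical half provides, for almost all \<open>\<pp>\<close>, that \<open>\<pp>\<close> is unramified, that the Frobenius
element exists and is unique, and that its defining congruence, which is one modulo \<open>\<pp>\<close>, holds
modulo \<open>p\<close> in the localization. All of this comes from one device, found by induction over the
finite Galois group \<open>G\<close>: there are algebraic integers \<open>b\<^sub>i\<close>, \<open>c\<^sub>i\<close> and an integer \<open>D \<noteq> 0\<close> such that
\<open>\<Sum>i. \<sigma> b\<^sub>i \<cdot> c\<^sub>i\<close> is \<open>D\<close> for \<open>\<sigma> = 1\<close> and \<open>0\<close> for the other \<open>\<sigma> \<in> G\<close>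
(\<open>exists_separating_family\<close>). Summation over \<open>G\<close> turns this into \<open>D \<cdot> x = \<Sum>i. Tr (x b\<^sub>i) \<cdot> c\<^sub>i\<close>, which
replaces dual bases and discriminants:

  \<^item> residue classes modulo an integer \<open>m \<noteq> 0\<close> are separated by the integers \<open>Tr (x b\<^sub>i)\<close> modulo \<open>D m\<close>, so
    \<open>\<O> / m \<O>\<close> is finite and only finitely many primes contain \<open>m\<close> (\<open>finite_primes_containing\<close>);
  \<^item> if \<open>p\<close> does not divide \<open>D\<close>, then \<open>\<O> / p \<O>\<close> is reduced (\<open>reduced_mod_p\<close>). A finite reduced ring has
    enough annihilators: some \<open>y \<notin> \<pp>\<close> satisfies \<open>y \<pp> \<subseteq> p \<O>\<close> (\<open>annihilator_mod_p\<close>). This makes \<open>\<pp>\<close>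
    unramified and shows that \<open>\<pp>\<close> and \<open>p\<close> generate the same ideal of the localization;
  \<^item> if \<open>D \<notin> \<pp>\<close>, the trace expansion writes \<open>x \<mapsto> x\<^sup>p\<close> modulo \<open>\<pp>\<close> as a combination of the
    automorphisms \<open>\<sigma>\<close> modulo \<open>\<pp>\<close>, and any \<open>\<sigma>\<close> with non-zero coefficient must agree with it
    (\<open>frobenius_exists\<close>).

Therefore the exceptional primes are among those that contain the non-zero integer \<open>D \<cdot> N\<close>, where
\<open>N\<close> is a common denominator of the coefficients of \<open>A\<close>.\<close>

section \<open>Congruences in a subring\<close>

text \<open>Congruences modulo \<open>p\<close> are needed in the ring of integers, in its localizations and in the Laurent
polynomials over them. All of these are subsets of a ring that is a whole type, hence subrings are
carried as sets.\<close>

locale unital_subring =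
  fixes S :: "'a::comm_ring_1 set"
  assumes one_mem: "1 \<in> S"
    and diff_mem: "x \<in> S \<Longrightarrow> y \<in> S \<Longrightarrow> x - y \<in> S"
    and mult_mem: "x \<in> S \<Longrightarrow> y \<in> S \<Longrightarrow> x * y \<in> S"
begin

lemma zero_mem: "0 \<in> S"
  using diff_mem[OF one_mem one_mem] by simp

lemma uminus_mem: "x \<in> S \<Longrightarrow> - x \<in> S"
  using diff_mem[OF zero_mem] by simp

lemma add_mem: "x \<in> S \<Longrightarrow> y \<in> S \<Longrightarrow> x + y \<in> S"
  using diff_mem[of x "- y"] uminus_mem by simp

lemma sum_mem: "(\<And>i. i \<in> I \<Longrightarrow> f i \<in> S) \<Longrightarrow> sum f I \<in> S"
  by (induction I rule: infinite_finite_induct) (auto intro: zero_mem add_mem)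

lemma prod_mem: "(\<And>i. i \<in> I \<Longrightarrow> f i \<in> S) \<Longrightarrow> prod f I \<in> S"
  by (induction I rule: infinite_finite_induct) (auto intro: one_mem mult_mem)

lemma power_mem: "x \<in> S \<Longrightarrow> x ^ n \<in> S"
  by (induction n) (auto intro: one_mem mult_mem)

lemma of_nat_mem: "of_nat n \<in> S"
  by (induction n) (auto intro: zero_mem one_mem add_mem)

lemma of_int_mem: "of_int n \<in> S"
  by (cases n) (auto intro: of_nat_mem uminus_mem diff_mem one_mem simp del: of_nat_Suc)

end

definition cong_modulo :: "'a::comm_ring_1 set \<Rightarrow> nat \<Rightarrow> 'a \<Rightarrow> 'a \<Rightarrow> bool" where
  "cong_modulo S m x y \<longleftrightarrow> x - y \<in> (\<lambda>z. of_nat m * z) ` S"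

context unital_subring
begin

lemma cong_moduloI: "z \<in> S \<Longrightarrow> x = y + of_nat m * z \<Longrightarrow> cong_modulo S m x y"
  by (auto simp: cong_modulo_def)

lemma cong_moduloE:
  assumes "cong_modulo S m x y"
  obtains z where "z \<in> S" "x = y + of_nat m * z"
  using assms by (auto simp: cong_modulo_def algebra_simps)

lemma cong_refl: "cong_modulo S m x x"
  using zero_mem by (auto intro!: cong_moduloI[of 0])

lemma cong_trans [trans]:
  assumes "cong_modulo S m x y" "cong_modulo S m y z"
  shows "cong_modulo S m x z"
proof -
  from assms obtain u v where "u \<in> S" "v \<in> S" "x = y + of_nat m * u" "y = z + of_nat m * v"
    by (auto elim!: cong_moduloE)
  then show ?thesis
    by (intro cong_moduloI[of "u + v"]) (auto simp: algebra_simps intro: add_mem)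
qed

lemma cong_sym:
  assumes "cong_modulo S m x y"
  shows "cong_modulo S m y x"
proof -
  from assms obtain z where "z \<in> S" "x = y + of_nat m * z" by (rule cong_moduloE)
  then show ?thesis by (intro cong_moduloI[of "- z"] uminus_mem) simp_all
qed

lemma cong_add:
  assumes "cong_modulo S m x y" "cong_modulo S m x' y'"
  shows "cong_modulo S m (x + x') (y + y')"
proof -
  from assms obtain u v where "u \<in> S" "v \<in> S" "x = y + of_nat m * u" "x' = y' + of_nat m * v"
    by (auto elim!: cong_moduloE)
  then show ?thesis
    by (intro cong_moduloI[of "u + v"]) (auto simp: algebra_simps intro: add_mem)
qed

lemma cong_mult:
  assumes "cong_modulo S m x y" "cong_modulo S m x' y'" "y \<in> S" "y' \<in> S"
  shows "cong_modulo S m (x * x') (y * y')"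
proof -
  from assms obtain u v where *: "u \<in> S" "v \<in> S" "x = y + of_nat m * u" "x' = y' + of_nat m * v"
    by (auto elim!: cong_moduloE)
  show ?thesis
  proof (rule cong_moduloI)
    show "y * v + u * y' + of_nat m * (u * v) \<in> S"
      using * assms by (intro add_mem mult_mem of_nat_mem)
  qed (simp add: * algebra_simps)
qed

lemma cong_sum:
  assumes "\<And>i. i \<in> I \<Longrightarrow> cong_modulo S m (f i) (g i)"
  shows "cong_modulo S m (sum f I) (sum g I)"
  using assms by (induction I rule: infinite_finite_induct) (auto intro: cong_refl cong_add)

section \<open>Rotation of words\<close>

text \<open>The orbits of \<open>f\<close> have \<open>1\<close> or \<open>p\<close> elements, since \<open>p\<close> is prime, and \<open>F\<close> is constant on them: an orbit
of \<open>p\<close> elements contributes a multiple of \<open>p\<close>. The induction removes one such orbit at a time.\<close>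

lemma sum_cong_sum_fixed_points:
  fixes f :: "'b \<Rightarrow> 'b"
  assumes "prime p"
    and "finite W"
    and "\<And>w. w \<in> W \<Longrightarrow> f w \<in> W"
    and "\<And>w. w \<in> W \<Longrightarrow> (f ^^ p) w = w"
    and "\<And>w. w \<in> W \<Longrightarrow> F (f w) = F w"
    and "\<And>w. w \<in> W \<Longrightarrow> F w \<in> S"
  shows "cong_modulo S p (sum F W) (sum F {w \<in> W. f w = w})"
  using assms(2-)
proof (induction "card W" arbitrary: W rule: less_induct)
  case less
  show ?case
  proof (cases "\<forall>w\<in>W. f w = w")
    case True
    then have "{w \<in> W. f w = w} = W" by blast
    then show ?thesis by (simp add: cong_refl)
  next
    case False
    then obtain w where w: "w \<in> W" "f w \<noteq> w" by blast
    have p0: "p > 0" using \<open>prime p\<close> by (simp add: prime_gt_0_nat)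
    have iter_W: "(f ^^ k) w \<in> W" for k
      by (induction k) (auto simp: w less.prems(2))
    have iter_mult: "(f ^^ (k * q)) w = w" if "(f ^^ k) w = w" for k q
      using that by (induction q) (auto simp: funpow_add)
    have iter_mod: "(f ^^ k) w = (f ^^ (k mod p)) w" for k
    proof -
      have "(f ^^ k) w = (f ^^ (k mod p + p * (k div p))) w" by simp
      also have "\<dots> = (f ^^ (k mod p)) w"
        unfolding funpow_add using iter_mult[OF less.prems(3)[OF w(1)]] by simp
      finally show ?thesis .
    qed
    have no_short_period: "(f ^^ k) w \<noteq> w" if "0 < k" "k < p" for k
    proof
      assume k: "(f ^^ k) w = w"
      have "coprime k p"
        using that \<open>prime p\<close> by (metis coprime_commute nat_dvd_not_less prime_imp_coprime)
      \<comment> \<open>Two coprime periods force the period \<open>1\<close>.\<close>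
      then have "gcd k p = 1" by (simp add: coprime_iff_gcd_eq_1)
      then obtain a b where "k * a = p * b + 1"
        using bezout_nat[of k p] \<open>0 < k\<close> by auto
      then have "f w = (f ^^ (k * a)) w"
        using iter_mult[OF less.prems(3)[OF w(1)]] by simp
      then show False using iter_mult[OF k] w(2) by simp
    qed
    have iter_inj: "i = j" if "(f ^^ i) w = (f ^^ j) w" "i \<le> j" "j < p" for i j
    proof (rule ccontr)
      assume "i \<noteq> j"
      have "w = (f ^^ (p - i + i)) w"
        using that less.prems(3)[OF w(1)] by simp
      also have "\<dots> = (f ^^ (p - i + j)) w"
        unfolding funpow_add using that(1) by simp
      also have "p - i + j = j - i + p" using that by simp
      also have "(f ^^ (j - i + p)) w = (f ^^ (j - i)) w"
        unfolding funpow_add using less.prems(3)[OF w(1)] by simp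
      finally show False
        using no_short_period[of "j - i"] that \<open>i \<noteq> j\<close> by (simp add: less_imp_diff_less)
    qed
    define Orb where "Orb = (\<lambda>k. (f ^^ k) w) ` {..<p}"
    have iter_Orb: "(f ^^ k) w \<in> Orb" for k
      unfolding Orb_def using p0 by (subst iter_mod) auto
    have Orb_W: "Orb \<subseteq> W" using iter_W by (auto simp: Orb_def)
    have inj: "inj_on (\<lambda>k. (f ^^ k) w) {..<p}"
      by (intro inj_onI) (metis iter_inj lessThan_iff linear)
    have F_iter: "F ((f ^^ k) w) = F w" for k
      by (induction k) (auto simp: less.prems(4) iter_W)
    have sum_Orb: "sum F Orb = of_nat p * F w"
      unfolding Orb_def by (simp add: sum.reindex[OF inj] F_iter)
    have f_Orb: "v \<in> Orb" if v: "v \<in> W" "f v \<in> Orb" for v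
    proof -
      obtain i where i: "f v = (f ^^ i) w" using v by (auto simp: Orb_def)
      have "v = (f ^^ Suc (p - 1)) v" using less.prems(3)[OF v(1)] p0 by simp
      also have "\<dots> = (f ^^ (p - 1)) (f v)" by (simp only: funpow_Suc_right o_def)
      also have "\<dots> = (f ^^ (p - 1 + i)) w" by (simp add: i funpow_add)
      finally show ?thesis using iter_Orb by metis
    qed
    have no_fix: "f v \<noteq> v" if "v \<in> Orb" for v
    proof
      assume "f v = v"
      obtain i where i: "v = (f ^^ i) w" "i < p"
        using \<open>v \<in> Orb\<close> unfolding Orb_def by blast
      have eq: "(f ^^ Suc i) w = (f ^^ i) w" using i \<open>f v = v\<close> by simp
      show False
      proof (cases "Suc i = p")
        case True
        then have "(f ^^ 0) w = (f ^^ i) w" using eq less.prems(3)[OF w(1)] by simp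
        then show ?thesis using iter_inj[of 0 i] i w eq by auto
      qed (use iter_inj[of i "Suc i"] i eq in auto)
    qed
    have "w \<in> Orb" using iter_Orb[of 0] by simp
    then have "card (W - Orb) < card W"
      using \<open>w \<in> W\<close> less.prems(1) by (intro psubset_card_mono) auto
    then have "cong_modulo S p (sum F (W - Orb)) (sum F {w \<in> W - Orb. f w = w})"
      using f_Orb less.prems by (intro less.hyps) auto
    moreover have "{w \<in> W - Orb. f w = w} = {w \<in> W. f w = w}" using no_fix by auto
    moreover have "sum F W = sum F (W - Orb) + of_nat p * F w"
      using sum.subset_diff[OF Orb_W less.prems(1), of F] sum_Orb by simp
    ultimately show ?thesis
      using cong_trans[OF cong_moduloI[of "F w" "sum F W" "sum F (W - Orb)" p]]
        less.prems(5)[OF w(1)] by simp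
  qed
qed

text \<open>The words that \<open>rotate1\<close> fixes are the constant ones.\<close>

lemma sum_words_cong:
  assumes p: "prime p" and "finite I"
    and rot: "\<And>w. set w \<subseteq> I \<Longrightarrow> length w = p \<Longrightarrow> F (rotate1 w) = F w"
    and mem: "\<And>w. set w \<subseteq> I \<Longrightarrow> length w = p \<Longrightarrow> F w \<in> S"
  shows "cong_modulo S p (\<Sum>w | set w \<subseteq> I \<and> length w = p. F w) (\<Sum>i\<in>I. F (replicate p i))"
proof -
  let ?W = "{w. set w \<subseteq> I \<and> length w = p}"
  have p0: "p > 0" using p by (simp add: prime_gt_0_nat)
  have "{w \<in> ?W. rotate1 w = w} = (\<lambda>i. replicate p i) ` I" (is "?L = ?R")
  proof
    show "?L \<subseteq> ?R"
    proof
      fix w assume "w \<in> ?L"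
      then have w: "set w \<subseteq> I" "length w = p" "rotate1 w = w" by auto
      then have "card (set w) = 1"
        using rotate1_fixpoint_card[of w] p0 by auto
      then obtain i where i: "set w = {i}" by (rule card_1_singletonE)
      then have "w = replicate p i"
        using w(2) replicate_length_same[of w i] by auto
      then show "w \<in> ?R" using w(1) i by auto
    qed
  qed (use p0 in auto)
  moreover have "inj_on (\<lambda>i. replicate p i) I"
    using p0 by (auto simp: inj_on_def)
  ultimately have "sum F {w \<in> ?W. rotate1 w = w} = (\<Sum>i\<in>I. F (replicate p i))"
    by (simp add: sum.reindex)
  moreover have "cong_modulo S p (sum F ?W) (sum F {w \<in> ?W. rotate1 w = w})"
    using assms
    by (intro sum_cong_sum_fixed_points finite_lists_length_eq) (auto simp flip: rotate_def)
  ultimately show ?thesis by simp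
qed

end

lemma sum_words_Suc:
  assumes "finite I"
  shows "(\<Sum>w | set w \<subseteq> I \<and> length w = Suc n. F w) =
    (\<Sum>i\<in>I. \<Sum>w | set w \<subseteq> I \<and> length w = n. F (i # w))"
proof -
  have "{w. set w \<subseteq> I \<and> length w = Suc n} =
      (\<lambda>(i, w). i # w) ` (I \<times> {w. set w \<subseteq> I \<and> length w = n})"
    by (auto simp: length_Suc_conv image_iff)
  moreover have "inj_on (\<lambda>(i, w). i # w) (I \<times> {w. set w \<subseteq> I \<and> length w = n})"
    by (auto simp: inj_on_def)
  ultimately show ?thesis
    using assms by (simp add: sum.reindex sum.cartesian_product finite_lists_length_eq case_prod_unfold)
qed

lemma power_sum_eq_sum_words:
  fixes f :: "'b \<Rightarrow> 'a::comm_semiring_1"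
  assumes "finite I"
  shows "(\<Sum>i\<in>I. f i) ^ n = (\<Sum>w | set w \<subseteq> I \<and> length w = n. prod_list (map f w))"
proof (induction n)
  case 0
  have "{w. set w \<subseteq> I \<and> w = []} = {[]}" by auto
  then show ?case by simp
next
  case (Suc n)
  then show ?case
    by (simp add: sum_words_Suc[OF assms] sum_product)
qed

text \<open>The multinomial form of the freshman's dream: the product of the letters of a word does not change
under rotation.\<close>

lemma (in unital_subring) power_sum_cong:
  assumes "prime p" "finite I" "\<And>i. i \<in> I \<Longrightarrow> f i \<in> S"
  shows "cong_modulo S p ((\<Sum>i\<in>I. f i) ^ p) (\<Sum>i\<in>I. f i ^ p)"
proof -
  have "prod_list (map f (rotate1 w)) = prod_list (map f w)" for w
    by (cases w) (auto simp: mult.commute)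
  moreover have "prod_list (map f w) \<in> S" if "set w \<subseteq> I" for w
    using that by (induction w) (auto intro: one_mem mult_mem assms)
  ultimately show ?thesis
    using sum_words_cong[OF assms(1,2), of "\<lambda>w. prod_list (map f w)"]
    by (simp add: power_sum_eq_sum_words[OF assms(2)] prod_list_replicate)
qed

section \<open>Closed walks and the trace of a power\<close>

text \<open>The word \<open>w\<close> lists the inner vertices of a walk from \<open>i\<close> to \<open>j\<close>.\<close>

fun walk_weight :: "'a::comm_ring_1 mat \<Rightarrow> nat \<Rightarrow> nat list \<Rightarrow> nat \<Rightarrow> 'a" where
  "walk_weight B i [] j = B $$ (i, j)"
| "walk_weight B i (k # w) j = B $$ (i, k) * walk_weight B k w j"

text \<open>A closed walk is recorded by its vertices without the return to the first one, so that a change of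
the starting point becomes a rotation of the word. The empty
word has the empty product as its weight.\<close>

fun cycle_weight :: "'a::comm_ring_1 mat \<Rightarrow> nat list \<Rightarrow> 'a" where
  "cycle_weight B [] = 1"
| "cycle_weight B (i # w) = walk_weight B i w i"

lemma walk_weight_snoc: "walk_weight B i (w @ [k]) j = walk_weight B i w k * B $$ (k, j)"
  by (induction w arbitrary: i) (auto simp: mult.assoc)

lemma cycle_weight_rotate1: "cycle_weight B (rotate1 w) = cycle_weight B w"
proof (cases w)
  case (Cons i v)
  then show ?thesis
    by (cases v) (auto simp: walk_weight_snoc mult.commute)
qed auto

lemma walk_weight_replicate: "walk_weight B i (replicate n i) i = B $$ (i, i) ^ Suc n"
  by (induction n) auto

lemma pow_mat_add_exp:
  assumes "B \<in> carrier_mat d d"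
  shows "B ^\<^sub>m (m + n) = B ^\<^sub>m m * B ^\<^sub>m n"
proof (induction n)
  case 0
  show ?case using assms by simp
next
  case (Suc n)
  then show ?case
    using assms assoc_mult_mat[of "B ^\<^sub>m m" d d "B ^\<^sub>m n" d B d] by simp
qed

lemma pow_mat_mult_exp:
  assumes "B \<in> carrier_mat d d"
  shows "B ^\<^sub>m (m * n) = (B ^\<^sub>m m) ^\<^sub>m n"
proof (induction n)
  case 0
  show ?case using assms by simp
next
  case (Suc n)
  have "B ^\<^sub>m (m * Suc n) = B ^\<^sub>m (m * n + m)" by (simp add: add.commute)
  then show ?case using Suc by (simp add: pow_mat_add_exp[OF assms])
qed

lemma pow_mat_eq_sum_walks:
  assumes B: "B \<in> carrier_mat d d" and "i < d" "j < d"
  shows "(B ^\<^sub>m Suc n) $$ (i, j) =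
    (\<Sum>w | set w \<subseteq> {..<d} \<and> length w = n. walk_weight B i w j)"
  using assms(2,3)
proof (induction n arbitrary: i)
  case 0
  have "{w. set w \<subseteq> {..<d} \<and> w = []} = {[]}" by auto
  then show ?case using B 0 by simp
next
  case (Suc n)
  have "B ^\<^sub>m Suc (Suc n) = B * B ^\<^sub>m Suc n"
    using pow_mat_add_exp[OF B, of 1 "Suc n"] B by simp
  then have "(B ^\<^sub>m Suc (Suc n)) $$ (i, j) = (B * B ^\<^sub>m Suc n) $$ (i, j)" by simp
  also have "\<dots> = (\<Sum>k<d. B $$ (i, k) * (B ^\<^sub>m Suc n) $$ (k, j))"
    using B Suc.prems by (simp add: scalar_prod_def atLeast0LessThan)
  also have "\<dots> = (\<Sum>k<d. \<Sum>w | set w \<subseteq> {..<d} \<and> length w = n. walk_weight B i (k # w) j)"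
    using Suc by (simp add: sum_distrib_left del: pow_mat.simps)
  finally show ?case by (simp add: sum_words_Suc)
qed

lemma sum_single_keys:
  "(\<Sum>v\<in>Poly_Mapping.keys f. Poly_Mapping.single v (Poly_Mapping.lookup f v)) = f"
  by (rule poly_mapping_eqI) (simp add: lookup_sum lookup_single when_def in_keys_iff)

context unital_subring
begin

lemma pow_mat_mem:
  assumes B: "B \<in> carrier_mat d d" and mem: "\<And>i j. i < d \<Longrightarrow> j < d \<Longrightarrow> B $$ (i, j) \<in> S"
    and ij: "i < d" "j < d"
  shows "(B ^\<^sub>m n) $$ (i, j) \<in> S"
  using ij
proof (induction n arbitrary: i j)
  case 0
  then show ?case using B by (auto simp: zero_mem one_mem)
next
  case (Suc n)
  then show ?case using B
    by (auto simp: scalar_prod_def intro!: sum_mem mult_mem mem)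
qed

text \<open>By \<open>cycle_weight_rotate1\<close>, only the loops at a single vertex count modulo \<open>p\<close>.\<close>

lemma trace_power_cong:
  assumes p: "prime p" and B: "B \<in> carrier_mat d d"
    and mem: "\<And>i j. i < d \<Longrightarrow> j < d \<Longrightarrow> B $$ (i, j) \<in> S"
  shows "cong_modulo S p (mat_trace (B ^\<^sub>m p)) (\<Sum>i<d. B $$ (i, i) ^ p)"
proof -
  obtain n where n: "p = Suc n" using p by (cases p) auto
  have "walk_weight B i w j \<in> S" if "i < d" "j < d" "set w \<subseteq> {..<d}" for i j w
    using that by (induction w arbitrary: i) (auto intro!: mem mult_mem)
  then have cyc: "cycle_weight B w \<in> S" if "set w \<subseteq> {..<d}" for w
    using that by (cases w) (auto simp: one_mem)
  have "mat_trace (B ^\<^sub>m p) = (\<Sum>i<d. (B ^\<^sub>m Suc n) $$ (i, i))"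
    using B by (simp add: mat_trace_def n)
  also have "\<dots> = (\<Sum>w | set w \<subseteq> {..<d} \<and> length w = p. cycle_weight B w)"
    by (simp add: n sum_words_Suc pow_mat_eq_sum_walks[OF B] del: pow_mat.simps)
  finally show ?thesis
    using sum_words_cong[OF p, of "{..<d}" "cycle_weight B"] cyc
    by (simp add: cycle_weight_rotate1 n walk_weight_replicate)
qed

section \<open>Constant terms of Laurent polynomials\<close>

definition laurent_over :: "('r, 'a) laurent_poly set" where
  "laurent_over = {f. \<forall>v. Poly_Mapping.lookup f v \<in> S}"

lemma unital_subring_laurent_over: "unital_subring (laurent_over :: ('r, 'a) laurent_poly set)"
proof
  show "(1 :: ('r, 'a) laurent_poly) \<in> laurent_over"
    by (auto simp: laurent_over_def lookup_one when_def zero_mem one_mem)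
next
  fix f g :: "('r, 'a) laurent_poly"
  assume fg: "f \<in> laurent_over" "g \<in> laurent_over"
  then show "f - g \<in> laurent_over"
    by (auto simp: laurent_over_def lookup_minus intro: diff_mem)
  show "f * g \<in> laurent_over"
    using fg by (auto simp: laurent_over_def lookup_mult Sum_any.expand_set when_def zero_mem
        intro!: sum_mem mult_mem)
qed

lemma cst_cong:
  fixes f g :: "('r, 'a) laurent_poly"
  assumes "cong_modulo laurent_over m f g"
  shows "cong_modulo S m (cst f) (cst g)"
proof -
  from assms obtain h where h: "h \<in> laurent_over" "f = g + of_nat m * h"
    by (auto simp: cong_modulo_def algebra_simps)
  have "Poly_Mapping.lookup (of_nat m * h) v = of_nat m * Poly_Mapping.lookup h v" for v
    by (induction m) (auto simp: algebra_simps lookup_add)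
  with h show ?thesis
    by (intro cong_moduloI[of "cst h"]) (auto simp: cst_def laurent_over_def lookup_add)
qed

text \<open>Modulo \<open>p\<close>, the power \<open>f\<^sup>p\<close> is the sum of the \<open>p\<close>-th powers of the monomials of \<open>f\<close>. The exponent
\<open>p \<cdot> v\<close> of such a power vanishes only for \<open>v = 0\<close>.\<close>

lemma cst_power_cong:
  fixes f :: "('r, 'a) laurent_poly"
  assumes p: "prime p" and f: "f \<in> laurent_over"
  shows "cong_modulo S p (cst (f ^ p)) (cst f ^ p)"
proof -
  interpret L: unital_subring "laurent_over :: ('r, 'a) laurent_poly set"
    by (rule unital_subring_laurent_over)
  let ?K = "Poly_Mapping.keys f"
  let ?m = "\<lambda>v. Poly_Mapping.single v (Poly_Mapping.lookup f v)"
  have p0: "p > 0" using p by (simp add: prime_gt_0_nat)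
  have power_single: "Poly_Mapping.single v c ^ n = Poly_Mapping.single (\<lambda>i. int n * v i) (c ^ n)"
    for v :: "'r \<Rightarrow> int" and c :: 'a and n
  proof (induction n)
    case 0
    then show ?case by (simp add: single_one zero_fun_def[symmetric])
  next
    case (Suc n)
    then show ?case
      by (simp add: mult_single) (rule arg_cong2[where f = Poly_Mapping.single]; simp add: fun_eq_iff algebra_simps)
  qed
  have "?m v \<in> laurent_over" for v
    using f by (auto simp: laurent_over_def lookup_single when_def zero_mem)
  then have "cong_modulo laurent_over p ((\<Sum>v\<in>?K. ?m v) ^ p) (\<Sum>v\<in>?K. ?m v ^ p)"
    by (intro L.power_sum_cong p) auto
  then have "cong_modulo S p (cst (f ^ p)) (cst (\<Sum>v\<in>?K. ?m v ^ p))"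
    by (intro cst_cong) (simp add: sum_single_keys)
  moreover have "cst (\<Sum>v\<in>?K. ?m v ^ p) = (\<Sum>v\<in>?K. if v = 0 then Poly_Mapping.lookup f v ^ p else 0)"
    unfolding cst_def lookup_sum power_single
    by (intro sum.cong refl) (use p0 in \<open>auto simp: lookup_single when_def fun_eq_iff\<close>)
  moreover have "\<dots> = cst f ^ p"
    using p0 by (auto simp: cst_def in_keys_iff zero_power)
  ultimately show ?thesis by simp
qed

theorem cst_trace_power_cong:
  fixes B :: "('r, 'a) laurent_poly mat"
  assumes p: "prime p" and B: "B \<in> carrier_mat d d"
    and mem: "\<And>i j. i < d \<Longrightarrow> j < d \<Longrightarrow> B $$ (i, j) \<in> laurent_over"
  shows "cong_modulo S p (cst (mat_trace (B ^\<^sub>m p))) (\<Sum>i<d. cst (B $$ (i, i)) ^ p)"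
proof -
  interpret L: unital_subring "laurent_over :: ('r, 'a) laurent_poly set"
    by (rule unital_subring_laurent_over)
  have "cong_modulo S p (cst (mat_trace (B ^\<^sub>m p))) (cst (\<Sum>i<d. B $$ (i, i) ^ p))"
    by (intro cst_cong L.trace_power_cong[OF p B mem])
  also have "cst (\<Sum>i<d. B $$ (i, i) ^ p) = (\<Sum>i<d. cst (B $$ (i, i) ^ p))"
    by (simp add: cst_def lookup_sum)
  finally show ?thesis
    by (rule cong_trans) (auto intro!: cong_sum cst_power_cong p mem)
qed

end

section \<open>Algebraic integers\<close>

interpretation int_module: Modules.module "\<lambda>(n::int) (x::'k::field_char_0). of_int n * x"
  by unfold_locales (simp_all add: algebra_simps)

lemma subspace_int_module_preimage_mult:
  "int_module.subspace {v. (x::'k::field_char_0) * v \<in> int_module.span B}"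
  unfolding int_module.subspace_def
proof (intro conjI ballI allI)
  fix v w :: 'k and c :: int
  assume v: "v \<in> {v. x * v \<in> int_module.span B}"
  then show "of_int c * v \<in> {v. x * v \<in> int_module.span B}"
    using int_module.span_scale[of "x * v" B c] by (simp add: mult.left_commute)
  assume "w \<in> {v. x * v \<in> int_module.span B}"
  then show "v + w \<in> {v. x * v \<in> int_module.span B}"
    using v int_module.span_add[of "x * v" B "x * w"] by (simp add: distrib_left)
qed (simp add: int_module.span_zero)

lemma mult_span_closed:
  fixes x :: "'k::field_char_0"
  assumes "\<And>b. b \<in> B \<Longrightarrow> x * b \<in> int_module.span B" and "v \<in> int_module.span B"
  shows "x * v \<in> int_module.span B"
  using int_module.span_minimal[OF _ subspace_int_module_preimage_mult[of x B], of B] assms by auto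

text \<open>Multiplication by \<open>x\<close> acts on the generators in \<open>B\<close> by an integer matrix that has \<open>x\<close> as an
eigenvalue, because the vector of the generators is an eigenvector. The characteristic polynomial of
this matrix is monic and has integer coefficients.\<close>

lemma algebraic_int_of_span:
  fixes x :: "'k::field_char_0"
  assumes "finite B" and "b0 \<in> B" "b0 \<noteq> 0"
    and stable: "\<And>b. b \<in> B \<Longrightarrow> x * b \<in> int_module.span B"
  shows "algebraic_int x"
proof -
  obtain e where e: "bij_betw e {..<card B} B"
    using ex_bij_betw_nat_finite[OF \<open>finite B\<close>] by (auto simp: atLeast0LessThan)
  have "\<forall>b\<in>B. \<exists>m. x * b = (\<Sum>c\<in>B. of_int (m c) * c)"
    using stable int_module.span_finite[OF \<open>finite B\<close>] by auto
  then obtain m where m: "\<And>b. b \<in> B \<Longrightarrow> x * b = (\<Sum>c\<in>B. of_int (m b c) * c)"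
    by metis
  define n where "n = card B"
  define M where "M = mat n n (\<lambda>(i, j). m (e i) (e j))"
  have M: "M \<in> carrier_mat n n" by (simp add: M_def)
  define v where "v = vec n e"
  have e_B: "e i \<in> B" if "i < n" for i
    using e that by (auto simp: bij_betw_def n_def)
  have "eigenvector (map_mat of_int M) v x"
    unfolding eigenvector_def
  proof (intro conjI)
    show "v \<in> carrier_vec (dim_row (map_mat of_int M))" using M by (simp add: v_def)
    show "map_mat of_int M *\<^sub>v v = x \<cdot>\<^sub>v v"
    proof (rule eq_vecI)
      fix i assume "i < dim_vec (x \<cdot>\<^sub>v v)"
      then have i: "i < n" by (simp add: v_def)
      have "(map_mat of_int M *\<^sub>v v) $ i = (\<Sum>j<n. of_int (m (e i) (e j)) * e j)"
        using i by (simp add: M_def v_def scalar_prod_def atLeast0LessThan)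
      also have "\<dots> = x * e i"
        using m[OF e_B[OF i]] sum.reindex_bij_betw[OF e, of "\<lambda>c. of_int (m (e i) c) * c"]
        by (simp add: n_def)
      finally show "(map_mat of_int M *\<^sub>v v) $ i = (x \<cdot>\<^sub>v v) $ i"
        using i by (simp add: v_def)
    qed (simp add: M_def v_def)
    obtain i where "i < n" "e i = b0"
      using e \<open>b0 \<in> B\<close> unfolding bij_betw_def n_def by (metis imageE lessThan_iff)
    then have "v $ i \<noteq> 0\<^sub>v n $ i" using \<open>b0 \<noteq> 0\<close> by (simp add: v_def)
    then show "v \<noteq> 0\<^sub>v (dim_row (map_mat of_int M))" using M by auto
  qed
  then have "poly (char_poly (map_mat of_int M)) x = 0"
    using M by (subst eigenvalue_root_char_poly[symmetric]) (auto simp: eigenvalue_def)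
  then have "poly (map_poly of_int (char_poly M)) x = 0"
    by (simp add: of_int_hom.char_poly_hom[OF M])
  moreover have "lead_coeff (char_poly M) = 1"
    using degree_monic_char_poly[OF M] by simp
  ultimately show ?thesis
    unfolding algebraic_int_altdef_ipoly by blast
qed

lemma algebraic_int_power_reduction:
  fixes x :: "'k::field_char_0"
  assumes "algebraic_int x"
  obtains a m where "x ^ m = (\<Sum>i<m. of_int (a i) * x ^ i)" "m > 0"
proof -
  obtain p where p: "poly (map_poly of_int p) x = 0" "lead_coeff p = 1"
    using assms unfolding algebraic_int_altdef_ipoly by blast
  define m where "m = degree p"
  have "m \<noteq> 0"
  proof
    assume "m = 0"
    then obtain c where c: "p = [:c:]" unfolding m_def by (rule degree_eq_zeroE)
    then have "p = 1" using p(2) by (simp add: one_pCons)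
    then show False using p(1) by simp
  qed
  have "(0::'k) = (\<Sum>i\<le>m. of_int (coeff p i) * x ^ i)"
    using p(1) by (simp add: poly_altdef m_def)
  also have "\<dots> = (\<Sum>i<m. of_int (coeff p i) * x ^ i) + x ^ m"
    using p(2) by (simp add: m_def flip: lessThan_Suc_atMost)
  finally have "x ^ m = (\<Sum>i<m. of_int (- coeff p i) * x ^ i)"
    by (simp add: sum_negf eq_neg_iff_add_eq_0 add.commute)
  then show ?thesis using that[of m "\<lambda>i. - coeff p i"] \<open>m \<noteq> 0\<close> by simp
qed

text \<open>If \<open>x\<close> and \<open>y\<close> satisfy monic integer equations of degrees \<open>m\<close> and \<open>n\<close>, the monomials \<open>x\<^sup>i y\<^sup>j\<close> with
\<open>i < m\<close> and \<open>j < n\<close> span a group that is stable under multiplication by \<open>x\<close> and by \<open>y\<close>.\<close>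

lemma algebraic_int_closed:
  fixes x y :: "'k::field_char_0"
  assumes "algebraic_int x" "algebraic_int y"
  shows algebraic_int_add: "algebraic_int (x + y)" and algebraic_int_mult: "algebraic_int (x * y)"
proof -
  obtain a m where x: "x ^ m = (\<Sum>i<m. of_int (a i) * x ^ i)" "m > 0"
    using assms(1) by (rule algebraic_int_power_reduction)
  obtain b n where y: "y ^ n = (\<Sum>i<n. of_int (b i) * y ^ i)" "n > 0"
    using assms(2) by (rule algebraic_int_power_reduction)
  define B where "B = (\<lambda>(i, j). x ^ i * y ^ j) ` ({..<m} \<times> {..<n})"
  have B: "finite B" "1 \<in> B"
    using x(2) y(2) by (force simp: B_def image_iff)+
  have mem: "x ^ i * y ^ j \<in> int_module.span B" if "i < m" "j < n" for i j
    using that by (intro int_module.span_base) (auto simp: B_def)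
  have stable_x: "x * v \<in> int_module.span B" if "v \<in> B" for v
  proof -
    from that obtain i j where ij: "v = x ^ i * y ^ j" "i < m" "j < n" by (auto simp: B_def)
    show ?thesis
    proof (cases "Suc i = m")
      case True
      then have "x * v = (\<Sum>k<m. of_int (a k) * (x ^ k * y ^ j))"
        using x(1) by (simp add: ij(1) sum_distrib_right flip: mult.assoc power_Suc)
      then show ?thesis
        using ij mem by (auto intro!: int_module.span_sum int_module.span_scale)
    next
      case False
      then show ?thesis using mem[of "Suc i" j] ij by (simp add: mult.assoc)
    qed
  qed
  have stable_y: "y * v \<in> int_module.span B" if "v \<in> B" for v
  proof -
    from that obtain i j where ij: "v = x ^ i * y ^ j" "i < m" "j < n" by (auto simp: B_def)
    show ?thesis
    proof (cases "Suc j = n")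
      case True
      then have "y * v = x ^ i * y ^ n"
        by (auto simp: ij(1) algebra_simps)
      also have "\<dots> = (\<Sum>k<n. of_int (b k) * (x ^ i * y ^ k))"
        using y(1) by (simp add: sum_distrib_left mult.left_commute)
      finally show ?thesis
        using ij mem by (auto intro!: int_module.span_sum int_module.span_scale)
    next
      case False
      then show ?thesis using mem[of i "Suc j"] ij by (simp add: algebra_simps)
    qed
  qed
  show "algebraic_int (x + y)"
    using B stable_x stable_y
    by (intro algebraic_int_of_span[of B 1]) (auto simp: distrib_right intro: int_module.span_add)
  show "algebraic_int (x * y)"
    using B stable_x stable_y
    by (intro algebraic_int_of_span[of B 1]) (auto simp: mult.assoc intro: mult_span_closed)
qed

text \<open>\<open>N\<close> clears the denominators of the rational matrix by which \<open>x\<close> acts on a finite spanning set.\<close>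

lemma number_field_common_denominator:
  fixes x :: "'k::field_char_0"
  assumes "number_field TYPE('k)"
  obtains N :: int where "N \<noteq> 0" "algebraic_int (of_int N * x)"
proof -
  interpret rat_module: Modules.module "\<lambda>(q::rat) (x::'k). of_rat q * x"
    by unfold_locales (simp_all add: algebra_simps of_rat_add of_rat_mult)
  obtain B :: "'k set" where B: "finite B" "rat_module.span B = UNIV"
    using assms by (auto simp: number_field_def)
  have "\<forall>b\<in>B. \<exists>q. x * b = (\<Sum>c\<in>B. of_rat (q c) * c)"
    using B(2) rat_module.span_finite[OF B(1)] by (auto simp: set_eq_iff)
  then obtain q where q: "\<And>b. b \<in> B \<Longrightarrow> x * b = (\<Sum>c\<in>B. of_rat (q b c) * c)"
    by metis
  define N where "N = (\<Prod>(b, c)\<in>B \<times> B. snd (quotient_of (q b c)))"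
  have "N \<noteq> 0"
    using B(1) quotient_of_denom_pos' by (auto simp: N_def less_le)
  have "\<exists>z. of_int N * of_rat (q b c) = (of_int z :: 'k)" if "b \<in> B" "c \<in> B" for b c
  proof -
    have "snd (quotient_of (q b c)) dvd N"
      unfolding N_def using dvd_prodI[of "B \<times> B" "(b, c)" "\<lambda>(b, c). snd (quotient_of (q b c))"] that B(1) by simp
    then obtain k where k: "N = snd (quotient_of (q b c)) * k" ..
    obtain n d where nd: "quotient_of (q b c) = (n, d)" by fastforce
    have "q b c = of_int n / of_int d" "d > 0"
      using nd quotient_of_div quotient_of_denom_pos by blast+
    then have "of_rat (q b c) = (of_int n / of_int d :: 'k)" by (simp add: of_rat_divide)
    then have "of_int N * of_rat (q b c) = (of_int (n * k) :: 'k)"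
      using \<open>d > 0\<close> k by (simp add: nd)
    then show ?thesis ..
  qed
  then obtain z where z: "\<And>b c. b \<in> B \<Longrightarrow> c \<in> B \<Longrightarrow> of_int N * of_rat (q b c) = (of_int (z b c) :: 'k)"
    by metis
  have "\<exists>b\<in>B. b \<noteq> 0"
  proof (rule ccontr)
    assume "\<not> ?thesis"
    then have "rat_module.span B \<subseteq> {0}"
      by (intro rat_module.span_minimal) (auto simp: rat_module.subspace_def)
    then show False using B(2) by (metis UNIV_I one_neq_zero singletonD subsetD)
  qed
  then obtain b0 where "b0 \<in> B" "b0 \<noteq> 0" by blast
  then have "algebraic_int (of_int N * x)"
  proof (intro algebraic_int_of_span[OF B(1)])
    fix b assume b: "b \<in> B"
    have "of_int N * x * b = (\<Sum>c\<in>B. of_int (z b c) * c)"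
      using q[OF b] z[OF b] by (simp add: mult.assoc sum_distrib_left) (simp flip: mult.assoc)
    then show "of_int N * x * b \<in> int_module.span B"
      by (simp only:) (intro int_module.span_sum int_module.span_scale int_module.span_base)
  qed
  then show ?thesis using that \<open>N \<noteq> 0\<close> by blast
qed

section \<open>The Galois group\<close>

lemma
  fixes \<sigma> :: "'k::field_char_0 \<Rightarrow> 'k"
  assumes "\<sigma> \<in> galois_group"
  shows galois_add: "\<sigma> (x + y) = \<sigma> x + \<sigma> y"
    and galois_diff: "\<sigma> (x - y) = \<sigma> x - \<sigma> y"
    and galois_mult: "\<sigma> (x * y) = \<sigma> x * \<sigma> y"
    and galois_divide: "\<sigma> (x / y) = \<sigma> x / \<sigma> y"
    and galois_0: "\<sigma> 0 = 0"
    and galois_1: "\<sigma> 1 = 1"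
    and galois_power: "\<sigma> (x ^ n) = \<sigma> x ^ n"
    and galois_of_nat: "\<sigma> (of_nat n) = of_nat n"
    and galois_of_int: "\<sigma> (of_int m) = of_int m"
    and galois_sum: "\<sigma> (sum f I) = (\<Sum>i\<in>I. \<sigma> (f i))"
    and galois_prod: "\<sigma> (prod f I) = (\<Prod>i\<in>I. \<sigma> (f i))"
    and galois_eq_0_iff: "\<sigma> x = 0 \<longleftrightarrow> x = 0"
    and galois_bij: "bij \<sigma>"
proof -
  interpret \<sigma>: field_isom \<sigma> using assms by (simp add: galois_group_def)
  show "\<sigma> (x + y) = \<sigma> x + \<sigma> y" "\<sigma> (x - y) = \<sigma> x - \<sigma> y" "\<sigma> (x * y) = \<sigma> x * \<sigma> y"
    "\<sigma> (x / y) = \<sigma> x / \<sigma> y" "\<sigma> 0 = 0" "\<sigma> 1 = 1" "\<sigma> (x ^ n) = \<sigma> x ^ n"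
    "\<sigma> (of_nat n) = of_nat n" "\<sigma> (of_int m) = of_int m" "\<sigma> (sum f I) = (\<Sum>i\<in>I. \<sigma> (f i))"
    "\<sigma> (prod f I) = (\<Prod>i\<in>I. \<sigma> (f i))" "\<sigma> x = 0 \<longleftrightarrow> x = 0"
    by (simp_all add: hom_distribs)
  show "bij \<sigma>" by (simp add: bij_def \<sigma>.inj_f \<sigma>.surj)
qed

lemmas galois_simps = galois_add galois_diff galois_mult galois_divide galois_0 galois_1
  galois_power galois_of_nat galois_of_int galois_sum galois_prod galois_eq_0_iff

lemma galois_groupI:
  fixes \<sigma> :: "'k::field_char_0 \<Rightarrow> 'k"
  assumes "\<And>x y. \<sigma> (x + y) = \<sigma> x + \<sigma> y" "\<And>x y. \<sigma> (x * y) = \<sigma> x * \<sigma> y" "\<sigma> 0 = 0" "\<sigma> 1 = 1" "surj \<sigma>"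
  shows "\<sigma> \<in> galois_group"
  unfolding galois_group_def by simp (unfold_locales, use assms in auto)

lemma id_galois: "id \<in> galois_group"
  by (rule galois_groupI) auto

lemma comp_galois:
  assumes "\<sigma> \<in> galois_group" "\<tau> \<in> galois_group"
  shows "\<sigma> \<circ> \<tau> \<in> galois_group"
proof (rule galois_groupI)
  show "surj (\<sigma> \<circ> \<tau>)"
    by (intro bij_is_surj bij_comp galois_bij assms)
qed (simp_all add: galois_simps assms)

lemma inv_galois:
  assumes "\<sigma> \<in> galois_group"
  shows "inv_into UNIV \<sigma> \<in> galois_group"
proof -
  interpret \<sigma>: field_isom \<sigma> using assms by (simp add: galois_group_def)
  show ?thesis
    by (rule galois_groupI)
      (auto simp: \<sigma>.inv.hom_add \<sigma>.inv.hom_mult bij_betw_inv_into bij_is_surj galois_bij[OF assms])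
qed

lemma galois_inv_inverse:
  assumes "\<sigma> \<in> galois_group"
  shows "\<sigma> (inv_into UNIV \<sigma> x) = x" "inv_into UNIV \<sigma> (\<sigma> x) = x"
  using galois_bij[OF assms] by (auto simp: bij_def surj_f_inv_f)

lemma bij_betw_comp_galois:
  assumes "\<tau> \<in> galois_group"
  shows "bij_betw (\<lambda>\<sigma>. \<tau> \<circ> \<sigma>) galois_group galois_group"
  by (rule bij_betw_byWitness[of _ "\<lambda>\<sigma>. inv_into UNIV \<tau> \<circ> \<sigma>"])
    (use assms in \<open>auto simp: fun_eq_iff galois_inv_inverse intro: comp_galois inv_galois\<close>)

lemma algebraic_int_galois:
  assumes "\<sigma> \<in> galois_group" "algebraic_int x"
  shows "algebraic_int (\<sigma> x)"
proof -
  obtain p where p: "poly (map_poly of_int p) x = 0" "lead_coeff p = 1"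
    using assms(2) unfolding algebraic_int_altdef_ipoly by blast
  have "poly (map_poly of_int p) (\<sigma> x) = \<sigma> (poly (map_poly of_int p) x)"
    using assms(1) by (simp add: poly_altdef galois_simps)
  then show ?thesis
    using p galois_0[OF assms(1)] unfolding algebraic_int_altdef_ipoly by metis
qed

text \<open>The conjugates of an algebraic integer are roots of one and the same integer polynomial; a general
element is reduced to this case by clearing its denominator.\<close>

lemma finite_conjugates:
  fixes x :: "'k::field_char_0"
  assumes "number_field TYPE('k)"
  shows "finite ((\<lambda>\<sigma>. \<sigma> x) ` galois_group)"
proof -
  obtain N :: int where N: "N \<noteq> 0" "algebraic_int (of_int N * x)"
    using number_field_common_denominator[OF assms] by metis
  obtain p where p: "poly (map_poly of_int p) (of_int N * x) = 0" "lead_coeff p = 1"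
    using N(2) unfolding algebraic_int_altdef_ipoly by blast
  let ?R = "{y :: 'k. poly (map_poly of_int p) y = 0}"
  have "p \<noteq> 0" using p(2) by auto
  then have "finite ?R" by (intro poly_roots_finite) simp
  have "\<sigma> x \<in> (\<lambda>y. y / of_int N) ` ?R" if "\<sigma> \<in> galois_group" for \<sigma>
  proof
    show "\<sigma> x = of_int N * \<sigma> x / of_int N" using N(1) by simp
    have "poly (map_poly of_int p) (of_int N * \<sigma> x) = \<sigma> (poly (map_poly of_int p) (of_int N * x))"
      using that by (simp add: poly_altdef galois_simps)
    then show "of_int N * \<sigma> x \<in> ?R" using p(1) that by (simp add: galois_0)
  qed
  then show ?thesis
    using \<open>finite ?R\<close> by (meson finite_imageI finite_subset image_subsetI)
qed

text \<open>An automorphism is determined by its values on a finite spanning set, and each of these values is one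
of finitely many conjugates.\<close>

lemma finite_galois_group:
  assumes "number_field TYPE('k::field_char_0)"
  shows "finite (galois_group :: ('k \<Rightarrow> 'k) set)"
proof -
  interpret rat_module: Modules.module "\<lambda>(q::rat) (x::'k). of_rat q * x"
    by unfold_locales (simp_all add: algebra_simps of_rat_add of_rat_mult)
  obtain B :: "'k set" where B: "finite B" "rat_module.span B = UNIV"
    using assms by (auto simp: number_field_def)
  have "inj_on (\<lambda>\<sigma>. restrict \<sigma> B) (galois_group :: ('k \<Rightarrow> 'k) set)"
  proof (rule inj_onI)
    fix \<sigma> \<tau> :: "'k \<Rightarrow> 'k"
    assume G: "\<sigma> \<in> galois_group" "\<tau> \<in> galois_group" and eq: "restrict \<sigma> B = restrict \<tau> B"
    interpret \<sigma>: field_hom \<sigma> using G(1) by (simp add: galois_group_def field_isom_def)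
    interpret \<tau>: field_hom \<tau> using G(2) by (simp add: galois_group_def field_isom_def)
    have rat: "\<sigma> (of_rat q) = of_rat q" "\<tau> (of_rat q) = of_rat q" for q
      by (cases q; simp add: of_rat_rat galois_simps G)+
    have "B \<subseteq> {x. \<sigma> x = \<tau> x}"
      using eq by (metis (mono_tags, lifting) mem_Collect_eq restrict_apply' subsetI)
    moreover have "rat_module.subspace {x. \<sigma> x = \<tau> x}"
      using G by (auto simp: rat_module.subspace_def galois_simps rat)
    ultimately have "rat_module.span B \<subseteq> {x. \<sigma> x = \<tau> x}"
      by (rule rat_module.span_minimal)
    then show "\<sigma> = \<tau>" using B(2) by auto
  qed
  moreover have "(\<lambda>\<sigma>. restrict \<sigma> B) ` galois_group \<subseteq> (\<Pi>\<^sub>E b\<in>B. (\<lambda>\<sigma>. \<sigma> b) ` galois_group)"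
    by auto
  then have "finite ((\<lambda>\<sigma>. restrict \<sigma> B) ` (galois_group :: ('k \<Rightarrow> 'k) set))"
    using finite_PiE[OF B(1)] finite_conjugates[OF assms] by (meson finite_subset)
  ultimately show ?thesis by (rule finite_imageD[rotated])
qed

interpretation integers: unital_subring "{x :: 'k::field_char_0. algebraic_int x}"
proof
  fix x y :: 'k
  assume "x \<in> {x. algebraic_int x}" "y \<in> {x. algebraic_int x}"
  then show "x - y \<in> {x. algebraic_int x}"
    using algebraic_int_add[of x "- y"] by simp
qed (auto intro: algebraic_int_mult)

locale galois_number_field =
  fixes K :: "'k::field_char_0 itself"
  assumes number_field: "number_field K" and galois: "galois_over_rationals K"
begin

lemma finite_galois: "finite (galois_group :: ('k \<Rightarrow> 'k) set)"
  using finite_galois_group number_field by (simp add: number_field_def)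

lemma galois_invariant_algebraic_int:
  assumes "algebraic_int x" "\<And>\<sigma>. \<sigma> \<in> galois_group \<Longrightarrow> \<sigma> x = (x :: 'k)"
  obtains t :: int where "x = of_int t"
proof -
  have "x \<in> \<rat>" using assms(2) galois by (auto simp: galois_over_rationals_def)
  then have "x \<in> \<int>" using assms(1) by (intro rational_algebraic_int_is_int)
  then show ?thesis using that by (auto elim: Ints_cases)
qed

definition trace :: "'k \<Rightarrow> 'k" where
  "trace x = (\<Sum>\<sigma>\<in>galois_group. \<sigma> x)"

lemma trace_diff: "trace (x - y) = trace x - trace y"
  by (simp add: trace_def galois_diff sum_subtractf cong: sum.cong)

lemma trace_of_int_mult: "trace (of_int m * x) = of_int m * trace x"
  by (simp add: trace_def galois_mult galois_of_int sum_distrib_left cong: sum.cong)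

lemma trace_int:
  assumes "algebraic_int x"
  obtains t :: int where "trace x = of_int t"
proof (rule galois_invariant_algebraic_int)
  show "algebraic_int (trace x)"
    using integers.sum_mem[of galois_group "\<lambda>\<sigma>. \<sigma> x"] assms
    by (simp add: trace_def algebraic_int_galois)
  show "\<tau> (trace x) = trace x" if "\<tau> \<in> galois_group" for \<tau>
    using sum.reindex_bij_betw[OF bij_betw_comp_galois[OF that], of "\<lambda>\<sigma>. \<sigma> x"]
    by (simp add: trace_def galois_sum[OF that])
qed (use that in blast)

text \<open>The multiplier is the product of the other conjugates, so that the integer is the norm of \<open>x\<close>.\<close>

lemma integer_multiple:
  assumes "algebraic_int x" "x \<noteq> (0::'k)"
  obtains y and t :: int where "algebraic_int y" "t \<noteq> 0" "x * y = of_int t"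
proof -
  let ?y = "\<Prod>\<sigma>\<in>galois_group - {id}. \<sigma> x"
  let ?n = "\<Prod>\<sigma>\<in>galois_group. \<sigma> x"
  have y: "algebraic_int ?y"
    using integers.prod_mem[of "galois_group - {id}" "\<lambda>\<sigma>. \<sigma> x"] assms
    by (simp add: algebraic_int_galois)
  have xy: "x * ?y = ?n"
    using prod.remove[OF finite_galois id_galois, of "\<lambda>\<sigma>. \<sigma> x"] by simp
  have "algebraic_int ?n"
    using y assms xy by (metis algebraic_int_mult)
  moreover have "\<tau> ?n = ?n" if "\<tau> \<in> galois_group" for \<tau>
    using prod.reindex_bij_betw[OF bij_betw_comp_galois[OF that], of "\<lambda>\<sigma>. \<sigma> x"]
    by (simp add: galois_prod[OF that])
  ultimately obtain t :: int where t: "?n = of_int t"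
    by (rule galois_invariant_algebraic_int)
  have "?n \<noteq> 0"
    using assms finite_galois by (auto simp: galois_eq_0_iff)
  then have "t \<noteq> 0" using t by auto
  then show ?thesis using that y xy t by simp
qed

section \<open>A separating family and the trace\<close>

text \<open>Think of the list as the element \<open>\<Sum> b \<otimes> c\<close> of the tensor square of the ring of integers. For
each \<open>\<sigma>\<close>, the map \<open>b \<otimes> c \<mapsto> \<sigma> b \<cdot> c\<close> is a ring homomorphism. If \<open>\<tau> x \<noteq> x\<close>, the factor
\<open>x \<otimes> 1 - 1 \<otimes> \<tau> x\<close> is sent to \<open>0\<close> for \<open>\<sigma> = \<tau>\<close> and to \<open>x - \<tau> x \<noteq> 0\<close> for \<open>\<sigma> = 1\<close>. The list
represents the product of such factors, one for each \<open>\<tau> \<in> T\<close>.\<close>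

lemma separating_list:
  assumes "finite T" "T \<subseteq> galois_group - {id}"
  shows "\<exists>L :: ('k \<times> 'k) list. (\<forall>(b, c)\<in>set L. algebraic_int b \<and> algebraic_int c) \<and>
    (\<forall>\<sigma>\<in>T. (\<Sum>(b, c)\<leftarrow>L. \<sigma> b * c) = 0) \<and> (\<Sum>(b, c)\<leftarrow>L. b * c) \<noteq> 0"
  using assms
proof (induction T rule: finite_induct)
  case empty
  show ?case by (intro exI[of _ "[(1, 1)]"]) auto
next
  case (insert \<tau> T)
  then obtain L :: "('k \<times> 'k) list" where L: "\<And>b c. (b, c) \<in> set L \<Longrightarrow> algebraic_int b \<and> algebraic_int c"
    "\<And>\<sigma>. \<sigma> \<in> T \<Longrightarrow> (\<Sum>(b, c)\<leftarrow>L. \<sigma> b * c) = 0" "(\<Sum>(b, c)\<leftarrow>L. b * c) \<noteq> 0"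
    by fastforce
  have \<tau>: "\<tau> \<in> galois_group" "\<tau> \<noteq> id" using insert.prems by auto
  then obtain x0 where x0: "\<tau> x0 \<noteq> x0" by (auto simp: fun_eq_iff)
  obtain N :: int where N: "N \<noteq> 0" "algebraic_int (of_int N * x0)"
    using number_field_common_denominator[of x0] number_field by (auto simp: number_field_def)
  define x where "x = of_int N * x0"
  have x: "algebraic_int x" "\<tau> x \<noteq> x"
    using N x0 by (auto simp: x_def galois_mult galois_of_int \<tau>)
  \<comment> \<open>Multiplication by \<open>x \<otimes> 1 - 1 \<otimes> \<tau> x\<close>.\<close>
  define L' where "L' = map (\<lambda>(b, c). (b * x, c)) L @ map (\<lambda>(b, c). (b, - (\<tau> x * c))) L"
  have L': "(\<Sum>(b, c)\<leftarrow>L'. \<sigma> b * c) = (\<Sum>(b, c)\<leftarrow>L. \<sigma> b * c) * (\<sigma> x - \<tau> x)"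
    if \<sigma>: "\<sigma> \<in> galois_group" for \<sigma>
    unfolding L'_def
    by (induction L) (auto simp: galois_mult[OF \<sigma>] algebra_simps)
  have "(\<Sum>(b, c)\<leftarrow>L'. \<sigma> b * c) = 0" if "\<sigma> \<in> insert \<tau> T" for \<sigma>
    using that insert.prems L(2)[of \<sigma>] by (subst L') auto
  moreover have "(\<Sum>(b, c)\<leftarrow>L'. b * c) \<noteq> 0"
    using L'[OF id_galois] L(3) x(2) by simp
  moreover have "algebraic_int b \<and> algebraic_int c" if "(b, c) \<in> set L'" for b c
    using that L(1) x(1) algebraic_int_galois[OF \<tau>(1) x(1)]
    by (auto simp: L'_def intro: algebraic_int_mult)
  ultimately show ?case by (intro exI[of _ L']) auto
qed

text \<open>The value at \<open>\<sigma> = 1\<close>, so far a non-zero algebraic integer, becomes an ordinary integer when the \<open>c\<^sub>i\<close>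
are multiplied by the product of its other conjugates.\<close>

theorem exists_separating_family:
  obtains D :: int and n and b c :: "nat \<Rightarrow> 'k"
  where "D \<noteq> 0" "\<And>i. algebraic_int (b i)" "\<And>i. algebraic_int (c i)"
    and "\<And>\<sigma>. \<sigma> \<in> galois_group \<Longrightarrow> (\<Sum>i<n. \<sigma> (b i) * c i) = (if \<sigma> = id then of_int D else 0)"
proof -
  obtain L :: "('k \<times> 'k) list" where L: "\<And>b c. (b, c) \<in> set L \<Longrightarrow> algebraic_int b \<and> algebraic_int c"
    "\<And>\<sigma>. \<sigma> \<in> galois_group - {id} \<Longrightarrow> (\<Sum>(b, c)\<leftarrow>L. \<sigma> b * c) = 0" "(\<Sum>(b, c)\<leftarrow>L. b * c) \<noteq> 0"
    using separating_list[of "galois_group - {id}"] finite_galois by fastforce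
  have "algebraic_int (\<Sum>(b, c)\<leftarrow>L. b * c)"
    using L(1)
  proof (induction L)
    case (Cons a L)
    then show ?case by (cases a) (auto intro!: algebraic_int_add algebraic_int_mult)
  qed auto
  then obtain y and D :: int where y: "algebraic_int y" "D \<noteq> 0" "(\<Sum>(b, c)\<leftarrow>L. b * c) * y = of_int D"
    using L(3) by (rule integer_multiple)
  define b where "b i = (if i < length L then fst (L ! i) else 0)" for i
  define c where "c i = (if i < length L then snd (L ! i) * y else 0)" for i
  have sum: "(\<Sum>i<length L. \<sigma> (b i) * c i) = (\<Sum>(b, c)\<leftarrow>L. \<sigma> b * c) * y" for \<sigma>
    by (simp add: b_def c_def sum_list_sum_nth atLeast0LessThan sum_distrib_right case_prod_unfold mult.assoc)
  show ?thesis
  proof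
    show "D \<noteq> 0" by fact
    have nth: "algebraic_int (fst (L ! i)) \<and> algebraic_int (snd (L ! i))" if "i < length L" for i
      using L(1)[of "fst (L ! i)" "snd (L ! i)"] that by simp
    show "algebraic_int (b i)" "algebraic_int (c i)" for i
      using nth[of i] y(1) by (auto simp: b_def c_def intro: algebraic_int_mult)
    show "(\<Sum>i<length L. \<sigma> (b i) * c i) = (if \<sigma> = id then of_int D else 0)"
      if "\<sigma> \<in> galois_group" for \<sigma>
      using L(2)[of \<sigma>] y(3) that by (simp add: sum)
  qed
qed

end

section \<open>Trace expansions and reducedness modulo primes\<close>

abbreviation cong_int :: "nat \<Rightarrow> 'k::field_char_0 \<Rightarrow> 'k \<Rightarrow> bool" where
  "cong_int \<equiv> cong_modulo {x. algebraic_int x}"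

text \<open>Fermat's little theorem, with the residue of \<open>t\<close> written as a sum of ones.\<close>

lemma (in unital_subring) of_int_power_cong:
  assumes p: "prime p"
  shows "cong_modulo S p (of_int t ^ p) (of_int t)"
proof -
  define r where "r = nat (t mod int p)"
  have p0: "p > 0" using p by (simp add: prime_gt_0_nat)
  have "cong_modulo S p ((\<Sum>i<r. 1) ^ p) (\<Sum>i<r. 1 ^ p)"
    by (intro power_sum_cong p) (auto intro: one_mem)
  then have "cong_modulo S p (of_nat r ^ p) (of_nat r)" by simp
  then obtain z where z: "z \<in> S" "of_nat r ^ p = of_nat r + of_nat p * z" by (rule cong_moduloE)
  have t: "t = int r + int p * (t div int p)"
    using p0 by (simp add: r_def)
  obtain q where q: "t ^ p - int r ^ p = (t - int r) * q"
    using power_diff_sumr2 by blast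
  have "t ^ p = int r ^ p + int p * ((t div int p) * q)"
  proof -
    have "t - int r = int p * (t div int p)" using t by linarith
    then have "t ^ p - int r ^ p = int p * ((t div int p) * q)" unfolding q by (simp add: mult.assoc)
    then show ?thesis by linarith
  qed
  then have "(of_int t :: 'a) ^ p = of_nat r ^ p + of_nat p * of_int ((t div int p) * q)"
    by (metis of_int_add of_int_mult of_int_of_nat_eq of_int_power)
  also have "\<dots> = of_int t + of_nat p * (z + of_int ((t div int p) * q) - of_int (t div int p))"
    by (subst (2) t) (simp add: z algebra_simps)
  finally show ?thesis
    by (rule cong_moduloI[rotated]) (intro z(1) add_mem diff_mem of_int_mem)
qed

lemma algebraic_int_prime_dvd:
  assumes "algebraic_int (z :: 'k::field_char_0)" "of_int t = of_nat p * z" "p > 0"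
  shows "int p dvd t"
proof -
  have "z = of_int t / of_nat p" using assms by simp
  then have "z \<in> \<rat>" by simp
  then obtain u where "z = of_int u"
    using rational_algebraic_int_is_int[OF assms(1)] by (auto elim: Ints_cases)
  then have "of_int t = (of_int (int p * u) :: 'k)" using assms by simp
  then have "t = int p * u" unfolding of_int_eq_iff .
  then show ?thesis by simp
qed

lemma cong_int_cancel:
  assumes "prime p" "\<not> int p dvd D" "algebraic_int x" "cong_int p (of_int D * x) 0"
  shows "cong_int p x 0"
proof -
  have "coprime (int p) D"
    using assms by (simp add: prime_imp_coprime)
  then obtain u v where uv: "u * int p + v * D = 1"
    by (metis bezout_int coprime_iff_gcd_eq_1)
  obtain z where z: "algebraic_int z" "of_int D * x = of_nat p * z"
    using assms(4) by (auto elim!: integers.cong_moduloE)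
  have "x = of_int (u * int p + v * D) * x" by (simp add: uv)
  also have "\<dots> = of_nat p * (of_int u * x) + of_int v * (of_int D * x)"
    by (simp add: algebra_simps)
  also have "\<dots> = 0 + of_nat p * (of_int u * x + of_int v * z)"
    unfolding z(2) by (simp add: algebra_simps)
  finally show ?thesis
    using assms(3) z(1)
    by (intro integers.cong_moduloI[of "of_int u * x + of_int v * z"])
      (auto intro!: algebraic_int_add algebraic_int_mult)
qed

locale separating_family = galois_number_field K
  for K :: "'k::field_char_0 itself" +
  fixes D :: int and n :: nat and b c :: "nat \<Rightarrow> 'k"
  assumes D: "D \<noteq> 0"
    and b_int: "algebraic_int (b i)" and c_int: "algebraic_int (c i)"
    and separating: "\<sigma> \<in> galois_group \<Longrightarrow> (\<Sum>i<n. \<sigma> (b i) * c i) = (if \<sigma> = id then of_int D else 0)"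
begin

lemma separating_pair:
  assumes "\<sigma> \<in> galois_group" "\<tau> \<in> galois_group"
  shows "(\<Sum>i<n. \<sigma> (b i) * \<tau> (c i)) = (if \<sigma> = \<tau> then of_int D else 0)"
proof -
  let ?\<rho> = "inv_into UNIV \<tau> \<circ> \<sigma>"
  have "?\<rho> = id \<longleftrightarrow> \<sigma> = \<tau>"
    using galois_inv_inverse[OF assms(2)] by (auto simp: fun_eq_iff) metis
  moreover have "(\<Sum>i<n. \<sigma> (b i) * \<tau> (c i)) = \<tau> (\<Sum>i<n. ?\<rho> (b i) * c i)"
    by (simp add: galois_sum galois_mult galois_inv_inverse assms)
  moreover have "?\<rho> \<in> galois_group" by (intro comp_galois inv_galois assms)
  ultimately show ?thesis
    using separating[of ?\<rho>] by (simp add: galois_of_int galois_0 assms)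
qed

text \<open>Expansion of the traces and summation over \<open>i\<close> first: only the term of \<open>\<sigma> = 1\<close> remains. Thus
\<open>c\<^sub>i / D\<close> behaves like a dual basis of \<open>b\<^sub>i\<close> for the trace form, and by symmetry the two roles can be
exchanged.\<close>

lemma trace_expansion: "(\<Sum>i<n. trace (x * b i) * c i) = of_int D * x"
proof -
  have "(\<Sum>i<n. trace (x * b i) * c i) = (\<Sum>i<n. \<Sum>\<sigma>\<in>galois_group. \<sigma> x * (\<sigma> (b i) * c i))"
    by (simp add: trace_def sum_distrib_right galois_mult mult.assoc cong: sum.cong)
  also have "\<dots> = (\<Sum>\<sigma>\<in>galois_group. \<sigma> x * (\<Sum>i<n. \<sigma> (b i) * c i))"
    by (subst sum.swap) (simp add: sum_distrib_left)
  also have "\<dots> = (\<Sum>\<sigma>\<in>galois_group. if \<sigma> = id then \<sigma> x * of_int D else 0)"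
    by (intro sum.cong refl) (simp add: separating)
  also have "\<dots> = of_int D * x"
    by (simp add: finite_galois id_galois)
  finally show ?thesis .
qed

lemma trace_expansion': "(\<Sum>i<n. trace (x * c i) * b i) = of_int D * x"
proof -
  have "(\<Sum>i<n. trace (x * c i) * b i) = (\<Sum>i<n. \<Sum>\<sigma>\<in>galois_group. \<sigma> x * (id (b i) * \<sigma> (c i)))"
    by (simp add: trace_def sum_distrib_left galois_mult mult_ac cong: sum.cong)
  also have "\<dots> = (\<Sum>\<sigma>\<in>galois_group. \<sigma> x * (\<Sum>i<n. id (b i) * \<sigma> (c i)))"
    by (subst sum.swap) (simp add: sum_distrib_left)
  also have "\<dots> = (\<Sum>\<sigma>\<in>galois_group. if \<sigma> = id then \<sigma> x * of_int D else 0)"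
    using separating_pair[OF id_galois] by (intro sum.cong refl) (simp add: eq_commute[of id])
  also have "\<dots> = of_int D * x"
    by (simp add: finite_galois id_galois)
  finally show ?thesis .
qed

text \<open>Finiteness of the residue class ring modulo \<open>m\<close>, in the form in which it is used: \<open>T\<close> is a finite
invariant that determines the residue class. It consists of the integers \<open>Tr (x b\<^sub>i)\<close> modulo \<open>D m\<close>;
the additional factor \<open>D\<close> pays for the \<open>D\<close> in the trace expansion.\<close>

lemma residue_classes:
  assumes "m \<noteq> (0::int)"
  obtains T :: "'k \<Rightarrow> nat \<Rightarrow> int" where "finite (T ` {x. algebraic_int x})"
    and "\<And>x y. algebraic_int x \<Longrightarrow> algebraic_int y \<Longrightarrow> T x = T y \<Longrightarrow>
      \<exists>z. algebraic_int z \<and> x = y + of_int m * z"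
proof -
  define N where "N = \<bar>D * m\<bar>"
  have N: "N > 0" using D assms by (simp add: N_def)
  have "\<exists>t. trace x = of_int t" if "algebraic_int x" for x
    using trace_int[OF that] by blast
  then obtain t where t: "\<And>x. algebraic_int x \<Longrightarrow> trace x = of_int (t x)" by metis
  define T where "T x = (\<lambda>i\<in>{..<n}. t (x * b i) mod N)" for x
  have "T ` {x. algebraic_int x} \<subseteq> (\<Pi>\<^sub>E i\<in>{..<n}. {0..<N})"
    unfolding T_def image_subset_iff restrict_PiE_iff using N by simp
  then have "finite (T ` {x. algebraic_int x})"
    by (rule finite_subset) (intro finite_PiE, auto)
  moreover have "\<exists>z. algebraic_int z \<and> x = y + of_int m * z"
    if xy: "algebraic_int x" "algebraic_int y" "T x = T y" for x y
  proof -
    have "\<exists>k. t (x * b i) - t (y * b i) = D * m * k" if "i < n" for i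
    proof -
      have "t (x * b i) mod N = t (y * b i) mod N"
        using fun_cong[OF xy(3), of i] that by (simp add: T_def)
      then have "D * m dvd t (x * b i) - t (y * b i)"
        by (simp add: N_def mod_eq_dvd_iff)
      then show ?thesis by (auto elim: dvdE)
    qed
    then obtain k where k: "\<And>i. i < n \<Longrightarrow> t (x * b i) - t (y * b i) = D * m * k i" by metis
    have "of_int D * (x - y) = (\<Sum>i<n. trace ((x - y) * b i) * c i)"
      by (simp add: trace_expansion)
    also have "\<dots> = (\<Sum>i<n. of_int (t (x * b i) - t (y * b i)) * c i)"
      using xy by (intro sum.cong refl)
        (simp add: left_diff_distrib trace_diff t b_int algebraic_int_mult)
    also have "\<dots> = (\<Sum>i<n. of_int D * (of_int m * (of_int (k i) * c i)))"
      by (intro sum.cong refl) (simp add: k)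
    also have "\<dots> = of_int D * (of_int m * (\<Sum>i<n. of_int (k i) * c i))"
      by (simp add: sum_distrib_left)
    finally have "x - y = of_int m * (\<Sum>i<n. of_int (k i) * c i)"
      using D by simp
    moreover have "algebraic_int (\<Sum>i<n. of_int (k i) * c i)"
      using integers.sum_mem[of "{..<n}" "\<lambda>i. of_int (k i) * c i"] c_int
      by (auto intro: algebraic_int_mult)
    ultimately show ?thesis by (metis add.commute diff_add_cancel)
  qed
  ultimately show ?thesis by (rule that)
qed

text \<open>If \<open>x\<^sup>p\<close> is divisible by \<open>p\<close>, so is \<open>Tr (x b\<^sub>i)\<^sup>p \<equiv> Tr (x\<^sup>p b\<^sub>i\<^sup>p)\<close>, hence so is the integer
\<open>Tr (x b\<^sub>i)\<close> itself. By the trace expansion, \<open>p\<close> divides \<open>D \<cdot> x\<close>, and \<open>D\<close> is invertible modulo \<open>p\<close>.\<close>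

lemma reduced_mod_p_step:
  fixes x :: 'k
  assumes p: "prime p" "\<not> int p dvd D" and x: "algebraic_int x" "cong_int p (x ^ p) 0"
  shows "cong_int p x 0"
proof -
  have p0: "p > 0" using p by (simp add: prime_gt_0_nat)
  obtain z where z: "algebraic_int z" "x ^ p = of_nat p * z"
    using x(2) by (auto elim!: integers.cong_moduloE)
  have tr: "\<exists>t. trace (x * b i) = of_int (int p * t)" for i
  proof -
    obtain s :: int where s: "trace (x * b i) = of_int s"
      using trace_int[of "x * b i"] x(1) b_int by (auto intro: algebraic_int_mult)
    have "cong_int p (trace (x * b i) ^ p) (\<Sum>\<sigma>\<in>galois_group. \<sigma> (x * b i) ^ p)"
      unfolding trace_def
      by (intro integers.power_sum_cong p finite_galois)
        (simp add: algebraic_int_galois algebraic_int_mult x b_int)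
    also have "(\<Sum>\<sigma>\<in>galois_group. \<sigma> (x * b i) ^ p) = trace ((x * b i) ^ p)"
      by (simp add: trace_def galois_power cong: sum.cong)
    also have "(x * b i) ^ p = of_int (int p) * (z * b i ^ p)"
      by (simp add: power_mult_distrib z)
    also have "trace \<dots> = of_nat p * trace (z * b i ^ p)"
      by (subst trace_of_int_mult) simp
    finally have "cong_int p (of_int s ^ p) (of_nat p * trace (z * b i ^ p))"
      by (simp add: s)
    moreover have "algebraic_int (trace (z * b i ^ p))"
      using trace_int[of "z * b i ^ p"] z(1) b_int integers.power_mem[of "b i" p]
      by (metis algebraic_int_mult algebraic_int_of_int mem_Collect_eq)
    then have "cong_int p (of_nat p * trace (z * b i ^ p)) 0"
      by (intro integers.cong_moduloI) auto
    ultimately have "cong_int p ((of_int s :: 'k) ^ p) 0"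
      by (rule integers.cong_trans)
    then have "cong_int p (of_int s :: 'k) 0"
      by (rule integers.cong_trans[OF integers.cong_sym[OF integers.of_int_power_cong[OF p(1)]]])
    then obtain w :: 'k where "algebraic_int w" "of_int s = of_nat p * w"
      by (auto elim!: integers.cong_moduloE)
    then have "int p dvd s" using p0 by (rule algebraic_int_prime_dvd)
    then show ?thesis using s by (auto elim!: dvdE)
  qed
  then obtain t where t: "\<And>i. trace (x * b i) = of_int (int p * t i)" by metis
  have "of_int D * x = 0 + of_nat p * (\<Sum>i<n. of_int (t i) * c i)"
    unfolding trace_expansion[symmetric] by (simp add: t sum_distrib_left mult.assoc)
  moreover have "algebraic_int (\<Sum>i<n. of_int (t i) * c i)"
    using integers.sum_mem[of "{..<n}" "\<lambda>i. of_int (t i) * c i"] c_int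
    by (auto intro: algebraic_int_mult)
  ultimately have "cong_int p (of_int D * x) 0"
    by (intro integers.cong_moduloI) auto
  then show ?thesis by (rule cong_int_cancel[OF p x(1)])
qed

lemma reduced_mod_p:
  fixes x :: 'k
  assumes p: "prime p" "\<not> int p dvd D" and x: "algebraic_int x" "cong_int p (x ^ k) 0"
  shows "cong_int p x 0"
proof -
  have "cong_int p (x ^ (p ^ k)) 0"
  proof -
    have "k \<le> p ^ k" using power_gt_expt[of p k] prime_gt_1_nat[OF p(1)] by simp
    then have "x ^ (p ^ k) = x ^ (p ^ k - k) * x ^ k" by (simp flip: power_add)
    moreover obtain z where "algebraic_int z" "x ^ k = of_nat p * z"
      using x(2) by (auto elim!: integers.cong_moduloE)
    ultimately show ?thesis
      using x(1) integers.power_mem[of x "p ^ k - k"]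
      by (intro integers.cong_moduloI[of "x ^ (p ^ k - k) * z"]) (auto intro: algebraic_int_mult)
  qed
  moreover have "cong_int p x 0" if "cong_int p (x ^ (p ^ j)) 0" for j
    using that
  proof (induction j)
    case (Suc j)
    then have "cong_int p ((x ^ (p ^ j)) ^ p) 0" by (simp add: mult.commute flip: power_mult)
    then have "cong_int p (x ^ (p ^ j)) 0"
      using x(1) integers.power_mem[of x "p ^ j"] by (intro reduced_mod_p_step[OF p, of "x ^ (p ^ j)"]) auto
    then show ?case by (rule Suc.IH)
  qed simp
  ultimately show ?thesis by blast
qed

end

lemma (in galois_number_field) separating_family_exists:
  obtains D n and b c :: "nat \<Rightarrow> 'k" where "separating_family K D n b c"
proof (rule exists_separating_family)
  fix D :: int and n :: nat and b c :: "nat \<Rightarrow> 'k"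
  assume "D \<noteq> 0" "\<And>i. algebraic_int (b i)" "\<And>i. algebraic_int (c i)"
    and "\<And>\<sigma>. \<sigma> \<in> galois_group \<Longrightarrow> (\<Sum>i<n. \<sigma> (b i) * c i) = (if \<sigma> = id then of_int D else 0)"
  then have "separating_family K D n b c" by unfold_locales
  then show thesis by (rule that)
qed

section \<open>Primes of the ring of integers\<close>

locale prime_of_integers =
  fixes P :: "'k::field_char_0 set"
  assumes nonzero_prime: "nonzero_prime P"
begin

sublocale primeideal P "\<O>"
  using nonzero_prime by (simp add: nonzero_prime_def)

lemma P_integral: "x \<in> P \<Longrightarrow> algebraic_int x"
  using Icarr by (simp add: ring_of_integers_def)

lemma P_zero: "0 \<in> P"
  using additive_subgroup.zero_closed[OF is_additive_subgroup] by (simp add: ring_of_integers_def)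

lemma P_add: "x \<in> P \<Longrightarrow> y \<in> P \<Longrightarrow> x + y \<in> P"
  using additive_subgroup.a_closed[OF is_additive_subgroup, of x y] by (simp add: ring_of_integers_def)

lemma P_mult: "x \<in> P \<Longrightarrow> algebraic_int y \<Longrightarrow> x * y \<in> P"
  using I_r_closed[of x y] by (simp add: ring_of_integers_def)

lemma P_diff: "x \<in> P \<Longrightarrow> y \<in> P \<Longrightarrow> x - y \<in> P"
  using P_add[of x "- y"] P_mult[of y "-1"] by simp

lemma P_sum: "(\<And>i. i \<in> I \<Longrightarrow> f i \<in> P) \<Longrightarrow> sum f I \<in> P"
  by (induction I rule: infinite_finite_induct) (auto intro: P_zero P_add)

lemma P_one: "1 \<notin> P"
proof
  assume "1 \<in> P"
  then have "carrier \<O> = P"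
    using P_mult[of 1] P_integral by (auto simp: ring_of_integers_def)
  then show False using I_notcarr by simp
qed

lemma P_prime: "x * y \<in> P \<Longrightarrow> algebraic_int x \<Longrightarrow> algebraic_int y \<Longrightarrow> x \<in> P \<or> y \<in> P"
  using I_prime[of x y] by (simp add: ring_of_integers_def)

lemma P_power: "x ^ n \<in> P \<Longrightarrow> algebraic_int x \<Longrightarrow> x \<in> P"
proof (induction n)
  case (Suc n)
  then show ?case using P_prime[of x "x ^ n"] integers.power_mem[of x n] by auto
qed (simp add: P_one)

lemma P_prod:
  assumes "finite I" "\<And>i. i \<in> I \<Longrightarrow> algebraic_int (f i) \<and> f i \<notin> P"
  shows "prod f I \<notin> P"
  using assms
proof (induction I rule: finite_induct)
  case (insert i I)
  then show ?case
    using P_prime[of "f i" "prod f I"] integers.prod_mem[of I f] by auto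
qed (simp add: P_one)

lemma localizationI:
  assumes "algebraic_int u" "algebraic_int v" "v \<notin> P"
  shows "u / v \<in> localization P"
  unfolding localization_def ring_of_integers_def using assms by auto

lemma localizationE:
  assumes "x \<in> localization P"
  obtains u v where "x = u / v" "algebraic_int u" "algebraic_int v" "v \<notin> P" "v \<noteq> 0"
  using assms P_zero unfolding localization_def ring_of_integers_def by auto

lemma unital_subring_localization: "unital_subring (localization P)"
proof
  show "1 \<in> localization P"
    using localizationI[of 1 1] P_one by simp
next
  fix x y assume "x \<in> localization P" "y \<in> localization P"
  then obtain u v s t where x: "x = u / v" "algebraic_int u" "algebraic_int v" "v \<notin> P" "v \<noteq> 0"
    and y: "y = s / t" "algebraic_int s" "algebraic_int t" "t \<notin> P" "t \<noteq> 0"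
    by (elim localizationE)
  have vt: "algebraic_int (v * t)" "v * t \<notin> P"
    using x y P_prime[of v t] by (auto intro: algebraic_int_mult)
  have eq: "x - y = (u * t - v * s) / (v * t)" "x * y = (u * s) / (v * t)"
    unfolding x(1) y(1) using x(5) y(5) by (simp_all add: field_simps)
  have int: "algebraic_int (u * t - v * s)" "algebraic_int (u * s)"
    using x y integers.diff_mem[of "u * t" "v * s"] by (simp_all add: algebraic_int_mult)
  show "x - y \<in> localization P" unfolding eq using int(1) vt by (rule localizationI)
  show "x * y \<in> localization P" unfolding eq using int(2) vt by (rule localizationI)
qed

end

locale prime_over = prime_of_integers P + galois_number_field K
  for P :: "'k::field_char_0 set" and K :: "'k::field_char_0 itself"
begin

text \<open>The norm of a non-zero element of \<open>P\<close> is a non-zero integer in \<open>P\<close>, and one of its prime factors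
lies in \<open>P\<close> as well.\<close>

lemma exists_prime_number: "\<exists>p. prime p \<and> of_nat p \<in> P"
proof -
  obtain x where x: "x \<in> P" "x \<noteq> 0"
    using nonzero_prime P_zero by (auto simp: nonzero_prime_def)
  obtain y and t :: int where y: "algebraic_int y" "t \<noteq> 0" "x * y = of_int t"
    using integer_multiple[OF P_integral[OF x(1)] x(2)] by blast
  then have "of_int t \<in> P" using P_mult[OF x(1)] by metis
  moreover have "(of_int t :: 'k) = of_nat (nat \<bar>t\<bar>) \<or> (of_int t :: 'k) = - of_nat (nat \<bar>t\<bar>)"
    by (simp add: abs_if)
  ultimately have "of_nat (nat \<bar>t\<bar>) \<in> P"
    using P_diff[OF P_zero, of "of_int t"] by auto
  then show ?thesis
    using y(2)
  proof (induction "nat \<bar>t\<bar>" arbitrary: t rule: less_induct)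
    case less
    let ?m = "nat \<bar>t\<bar>"
    have "?m \<noteq> 1"
    proof
      assume m: "?m = 1"
      show False using less.prems(1) P_one unfolding m by simp
    qed
    then obtain q where q: "prime q" "q dvd ?m" using prime_factor_nat by blast
    then obtain r where r: "?m = q * r" by (blast elim: dvdE)
    have "of_nat q \<in> P \<or> of_nat r \<in> P"
      using less.prems P_prime[of "of_nat q" "of_nat r"] by (simp add: r)
    then show ?case
    proof
      assume "of_nat r \<in> P"
      moreover have "r < ?m" "r > 0"
        using r q less.prems(2) prime_gt_1_nat[OF q(1)] by (auto intro!: Nat.gr0I)
      ultimately show ?thesis using less.hyps[of "int r"] by auto
    qed (use q in blast)
  qed
qed

lemma coprime_not_both:
  assumes "of_int s \<in> P" "of_int t \<in> P" shows "\<not> coprime s t"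
proof
  assume "coprime s t"
  then obtain u v where "u * s + v * t = 1"
    by (metis bezout_int coprime_iff_gcd_eq_1)
  then have "(1 :: 'k) = of_int s * of_int u + of_int t * of_int v"
    by (metis mult.commute of_int_1 of_int_add of_int_mult)
  moreover have "of_int s * of_int u + of_int t * of_int v \<in> P"
    using assms by (intro P_add P_mult) simp_all
  ultimately have "1 \<in> P" by simp
  then show False using P_one by simp
qed

definition p :: nat where "p = prime_below P"

lemma prime_p: "prime p" and p_mem: "of_nat p \<in> P"
proof -
  have "\<exists>!p. prime p \<and> of_nat p \<in> P"
  proof (rule ex_ex1I[OF exists_prime_number])
    fix q r assume *: "prime q \<and> of_nat q \<in> P" "prime r \<and> of_nat r \<in> P"
    show "q = r"
    proof (rule ccontr)
      assume "q \<noteq> r"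
      then have "coprime (int q) (int r)" using * by (simp add: primes_coprime)
      then show False using coprime_not_both[of "int q" "int r"] * by simp
    qed
  qed
  then have "prime p \<and> of_nat p \<in> P"
    unfolding p_def prime_below_def by (rule theI')
  then show "prime p" "of_nat p \<in> P" by auto
qed

lemma of_int_mem_iff: "of_int t \<in> P \<longleftrightarrow> int p dvd t"
proof
  assume "of_int t \<in> P"
  then have "\<not> coprime (int p) t"
    using p_mem by (intro coprime_not_both) simp_all
  then show "int p dvd t"
    using prime_p prime_imp_coprime[of "int p" t] by auto
next
  assume "int p dvd t"
  then obtain s where "t = int p * s" ..
  then show "of_int t \<in> P" using P_mult[OF p_mem, of "of_int s"] by simp
qed

lemma cong_mem:
  assumes "cong_int p x y" "y \<in> P" shows "x \<in> P"
proof -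
  obtain z where "algebraic_int z" "x = y + of_nat p * z"
    using assms(1) by (auto elim!: integers.cong_moduloE)
  then show ?thesis using assms(2) by (auto intro: P_add P_mult p_mem)
qed

end

context separating_family
begin

text \<open>A prime that contains \<open>m\<close> is a union of residue classes modulo \<open>m\<close>, and there are only finitely many
of these.\<close>

lemma finite_primes_containing:
  assumes "m \<noteq> (0::int)"
  shows "finite {P :: 'k set. nonzero_prime P \<and> of_int m \<in> P}"
proof -
  obtain T :: "'k \<Rightarrow> nat \<Rightarrow> int" where T: "finite (T ` {x. algebraic_int x})"
    "\<And>x y. algebraic_int x \<Longrightarrow> algebraic_int y \<Longrightarrow> T x = T y \<Longrightarrow>
      \<exists>z. algebraic_int z \<and> x = y + of_int m * z"
    using residue_classes[OF assms] by blast
  have sub: "P \<subseteq> Q" if P: "nonzero_prime P" and Q: "nonzero_prime Q" "of_int m \<in> Q"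
    and eq: "T ` P = T ` Q" for P Q
  proof
    interpret P: prime_of_integers P using P by unfold_locales
    interpret Q: prime_of_integers Q using Q by unfold_locales
    fix x assume x: "x \<in> P"
    then obtain y where y: "y \<in> Q" "T x = T y" using eq by (metis imageE image_eqI)
    then obtain z where "algebraic_int z" "x = y + of_int m * z"
      using T(2) P.P_integral[OF x] Q.P_integral by blast
    then show "x \<in> Q" using y Q by (auto intro: Q.P_add Q.P_mult)
  qed
  have "inj_on (\<lambda>P. T ` P) {P. nonzero_prime P \<and> of_int m \<in> P}"
    using sub by (intro inj_onI) (simp add: subset_antisym)
  moreover have "(\<lambda>P. T ` P) ` {P. nonzero_prime P \<and> of_int m \<in> P} \<subseteq> Pow (T ` {x. algebraic_int x})"
    by (auto dest!: prime_of_integers.P_integral[OF prime_of_integers.intro])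
  ultimately show ?thesis
    using T(1) by (meson finite_Pow_iff finite_imageD finite_subset)
qed

end

section \<open>Primes that do not divide the separating integer\<close>

locale good_prime = separating_family K D n b c + prime_over P K
  for P :: "'k::field_char_0 set" and K :: "'k::field_char_0 itself" and D n and b c :: "nat \<Rightarrow> 'k" +
  assumes D_notin: "of_int D \<notin> P"
begin

lemma p_not_dvd_D: "\<not> int p dvd D"
  using D_notin of_int_mem_iff by simp

text \<open>The powers of \<open>x\<close> repeat modulo \<open>p\<close>, say \<open>x\<^sup>i \<equiv> x\<^sup>j\<close> with \<open>i < j\<close>. Put \<open>y = 1 - x\<^bsup>j-i\<^esup>\<close>. Then
\<open>y x\<close> is nilpotent modulo \<open>p\<close>, hence zero.\<close>

lemma annihilator_mod_p_of_element:
  assumes x: "x \<in> P"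
  obtains y where "algebraic_int y" "y \<notin> P" "cong_int p (y * x) 0"
proof -
  obtain T :: "'k \<Rightarrow> nat \<Rightarrow> int" where T: "finite (T ` {x. algebraic_int x})"
    "\<And>x y. algebraic_int x \<Longrightarrow> algebraic_int y \<Longrightarrow> T x = T y \<Longrightarrow>
      \<exists>z. algebraic_int z \<and> x = y + of_int (int p) * z"
    using residue_classes[of "int p"] prime_p by auto
  have x_int: "algebraic_int x" "algebraic_int (x ^ k)" for k
    using P_integral[OF x] integers.power_mem[of x k] by auto
  have "\<not> inj (\<lambda>k. T (x ^ k))"
  proof
    assume "inj (\<lambda>k. T (x ^ k))"
    then have "infinite (range (\<lambda>k. T (x ^ k)))" by (rule range_inj_infinite)
    moreover have "range (\<lambda>k. T (x ^ k)) \<subseteq> T ` {x. algebraic_int x}" using x_int by auto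
    ultimately show False using T(1) finite_subset by blast
  qed
  then obtain i j where ij: "i < j" "T (x ^ i) = T (x ^ j)"
    unfolding inj_def by (metis linorder_neqE_nat)
  define y where "y = 1 - x ^ (j - i)"
  have y: "algebraic_int y" unfolding y_def
    using integers.diff_mem[of 1 "x ^ (j - i)"] x_int by simp
  obtain k where k: "j - i = Suc k" using ij(1) by (metis Suc_diff_Suc)
  have "x ^ (j - i) \<in> P"
    using P_mult[OF x x_int(2)[of k]] by (simp add: k)
  then have "y \<notin> P"
    using P_add[of y "x ^ (j - i)"] P_one by (auto simp: y_def)
  obtain z where z: "algebraic_int z" "x ^ i = x ^ j + of_nat p * z"
    using T(2)[OF x_int(2) x_int(2) ij(2)] by auto
  have "x ^ i * x ^ (j - i) = x ^ j"
    using ij(1) by (simp flip: power_add)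
  then have "x ^ i * y = x ^ i - x ^ j" by (simp add: y_def right_diff_distrib)
  also have "\<dots> = of_nat p * z" using z(2) by simp
  finally have "x ^ i * y = of_nat p * z" .
  then have "(y * x) ^ Suc i = 0 + of_nat p * (z * (y ^ i * x))"
    by (simp add: power_mult_distrib algebra_simps)
  moreover have "algebraic_int (z * (y ^ i * x))"
    using z(1) y x_int(1) integers.power_mem[of y i] by (auto intro: algebraic_int_mult)
  ultimately have "cong_int p ((y * x) ^ Suc i) 0"
    by (intro integers.cong_moduloI[of "z * (y ^ i * x)"]) simp_all
  then have "cong_int p (y * x) 0"
    by (rule reduced_mod_p[OF prime_p p_not_dvd_D algebraic_int_mult[OF y x_int(1)]])
  then show ?thesis by (rule that[OF y \<open>y \<notin> P\<close>])
qed

text \<open>One \<open>y\<close> for the whole of \<open>P\<close>: the product of the annihilators of representatives of its finitely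
many residue classes. It stays outside \<open>P\<close> because \<open>P\<close> is prime.\<close>

lemma annihilator_mod_p:
  obtains y where "algebraic_int y" "y \<notin> P" "\<And>x. x \<in> P \<Longrightarrow> cong_int p (y * x) 0"
proof -
  obtain T :: "'k \<Rightarrow> nat \<Rightarrow> int" where T: "finite (T ` {x. algebraic_int x})"
    "\<And>x y. algebraic_int x \<Longrightarrow> algebraic_int y \<Longrightarrow> T x = T y \<Longrightarrow>
      \<exists>z. algebraic_int z \<and> x = y + of_int (int p) * z"
    using residue_classes[of "int p"] prime_p by auto
  have fin: "finite (T ` P)"
    by (rule finite_subset[OF _ T(1)]) (auto dest: P_integral)
  define r where "r = inv_into P T"
  have r: "r t \<in> P \<and> T (r t) = t" if "t \<in> T ` P" for t
    using that by (simp add: r_def inv_into_into f_inv_into_f)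
  have "\<exists>y. algebraic_int y \<and> y \<notin> P \<and> cong_int p (y * r t) 0" if "t \<in> T ` P" for t
    using annihilator_mod_p_of_element[of "r t"] r[OF that] by blast
  then obtain y where y: "\<And>t. t \<in> T ` P \<Longrightarrow> algebraic_int (y t) \<and> y t \<notin> P \<and> cong_int p (y t * r t) 0"
    by metis
  let ?y = "\<Prod>t\<in>T ` P. y t"
  show ?thesis
  proof
    show y_int: "algebraic_int ?y" using integers.prod_mem[of "T ` P" y] y by simp
    show "?y \<notin> P" by (rule P_prod[OF fin]) (use y in blast)
    fix x assume x: "x \<in> P"
    then have t: "T x \<in> T ` P" by simp
    obtain z where z: "algebraic_int z" "x = r (T x) + of_nat p * z"
      using T(2)[of x "r (T x)"] r[OF t] P_integral x by auto
    obtain w where w: "algebraic_int w" "y (T x) * r (T x) = of_nat p * w"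
      using y[OF t] by (auto elim!: integers.cong_moduloE)
    let ?y' = "\<Prod>t\<in>T ` P - {T x}. y t"
    have y': "algebraic_int ?y'" using integers.prod_mem[of "T ` P - {T x}" y] y by simp
    have "?y * x = ?y * (r (T x) + of_nat p * z)" using z(2) by simp
    also have "\<dots> = (y (T x) * r (T x)) * ?y' + of_nat p * (?y * z)"
      unfolding prod.remove[OF fin t] by (simp add: algebra_simps)
    also have "\<dots> = 0 + of_nat p * (w * ?y' + ?y * z)"
      unfolding w(2) by (simp add: algebra_simps)
    finally show "cong_int p (?y * x) 0"
      using y_int y' z(1) w(1)
      by (intro integers.cong_moduloI[of "w * ?y' + ?y * z"])
        (auto intro!: algebraic_int_add algebraic_int_mult)
  qed
qed

text \<open>Multiplication by the annihilator \<open>y\<close> sends every product of two elements of \<open>P\<close> into \<open>p P\<close>. If \<open>p\<close>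
were a sum of such products, \<open>y p\<close> would lie in \<open>p P\<close>, that is, \<open>y\<close> in \<open>P\<close>.\<close>

lemma p_notin_ideal_prod:
  assumes "I \<subseteq> P"
  shows "of_nat p \<notin> ideal_prod \<O> I P"
proof
  assume p: "of_nat p \<in> ideal_prod \<O> I P"
  obtain y where y: "algebraic_int y" "y \<notin> P" "\<And>x. x \<in> P \<Longrightarrow> cong_int p (y * x) 0"
    by (rule annihilator_mod_p) blast
  have "\<exists>q\<in>P. y * z = of_nat p * q" if "z \<in> ideal_prod \<O> I P" for z
    using that
  proof (induction z rule: ideal_prod.induct)
    case (prod i j)
    then have "i \<in> P" using assms by blast
    from y(3)[OF this] obtain w where "algebraic_int w" "y * i = of_nat p * w"
      by (auto elim!: integers.cong_moduloE)
    then show ?case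
      using prod P_mult[of j w]
      by (intro bexI[of _ "j * w"]) (auto simp: ring_of_integers_def algebra_simps)
  next
    case (sum s t)
    then obtain u v where "u \<in> P" "v \<in> P" "y * s = of_nat p * u" "y * t = of_nat p * v" by blast
    then show ?case
      by (intro bexI[of _ "u + v"]) (auto simp: ring_of_integers_def algebra_simps P_add)
  qed
  from this[OF p] obtain q where "q \<in> P" "y * of_nat p = of_nat p * q" by blast
  then have "y = q" using prime_p by simp
  then show False using \<open>q \<in> P\<close> y(2) by simp
qed

text \<open>For \<open>e \<ge> 2\<close>, the power \<open>P\<^sup>e\<close> is the product of \<open>P\<close> with the ideal \<open>P\<^bsup>e-1\<^esup> \<subseteq> P\<close>, and no
such product contains \<open>p\<close>.\<close>

lemma unramified: "unramified P"
proof -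
  let ?pO = "PIdl\<^bsub>\<O>\<^esub> (of_nat p :: 'k)"
  let ?pow = "\<lambda>e::nat. P [^]\<^bsub>ideals_set \<O>\<^esub> e"
  have pow_Suc: "?pow (Suc e) = ideal_prod \<O> (?pow e) P" for e
    by (simp add: nat_pow_def ideals_set_def)
  have pow_0: "?pow 0 = carrier \<O>"
    by (simp add: nat_pow_def ideals_set_def)
  have pow_ideal: "ideal (?pow e) \<O>" for e
  proof (induction e)
    case 0
    show ?case unfolding pow_0 by (rule oneideal)
  next
    case (Suc e)
    then show ?case unfolding pow_Suc by (rule ideal_prod_is_ideal[OF _ ideal_axioms])
  qed
  have pow_sub: "?pow (Suc e) \<subseteq> P" for e
    unfolding pow_Suc using ideal_prod_inter[OF pow_ideal[of e] ideal_axioms] by blast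
  have "of_nat p \<in> carrier (\<O> :: 'k ring)" by (simp add: ring_of_integers_def)
  then have p_pO: "of_nat p \<in> ?pO" by (rule cgenideal_self)
  have "?pO \<subseteq> ?pow 1"
  proof
    fix x assume "x \<in> ?pO"
    then obtain z where "algebraic_int z" "x = z * of_nat p"
      by (auto simp: cgenideal_def ring_of_integers_def)
    then have "x \<in> ideal_prod \<O> (?pow 0) P"
      unfolding pow_0 using ideal_prod.prod[of z "carrier \<O>" "of_nat p" P \<O>] p_mem
      by (simp add: ring_of_integers_def)
    then show "x \<in> ?pow 1" using pow_Suc[of 0] by simp
  qed
  moreover have "e \<le> 1" if "?pO \<subseteq> ?pow e" for e
  proof (rule ccontr)
    assume "\<not> e \<le> 1"
    then obtain k where "e = Suc (Suc k)" by (metis One_nat_def Suc_le_mono le0 not0_implies_Suc)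
    then have "of_nat p \<in> ideal_prod \<O> (?pow (Suc k)) P"
      using that p_pO pow_Suc by blast
    then show False using p_notin_ideal_prod[OF pow_sub] by blast
  qed
  ultimately show ?thesis
    unfolding unramified_def ramification_index_def p_def[symmetric]
    by (intro Greatest_equality)
qed

section \<open>The Frobenius element\<close>

text \<open>The separating family detects \<open>\<sigma> \<noteq> \<tau>\<close> even modulo \<open>P\<close>: its value at the pair \<open>(\<tau>, \<tau>)\<close> is \<open>D \<notin> P\<close>
and at the pair \<open>(\<sigma>, \<tau>)\<close> it is \<open>0\<close>.\<close>

lemma frobenius_unique:
  assumes G: "\<sigma> \<in> galois_group" "\<tau> \<in> galois_group"
    and cong: "\<And>x. algebraic_int x \<Longrightarrow> \<sigma> x - \<tau> x \<in> P"
  shows "\<sigma> = \<tau>"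
proof (rule ccontr)
  assume "\<sigma> \<noteq> \<tau>"
  then have "of_int D = (\<Sum>i<n. \<tau> (b i) * \<tau> (c i)) - (\<Sum>i<n. \<sigma> (b i) * \<tau> (c i))"
    using separating_pair[OF G] separating_pair[OF G(2) G(2)] by simp
  also have "\<dots> = - (\<Sum>i<n. (\<sigma> (b i) - \<tau> (b i)) * \<tau> (c i))"
    by (simp add: left_diff_distrib sum_subtractf)
  finally have eq: "of_int D = 0 - (\<Sum>i<n. (\<sigma> (b i) - \<tau> (b i)) * \<tau> (c i))" by simp
  have "of_int D \<in> P"
    unfolding eq by (intro P_diff P_zero P_sum P_mult cong b_int algebraic_int_galois[OF G(2) c_int])
  then show False using D_notin by simp
qed

text \<open>Write \<open>\<phi>\<close> for the \<open>p\<close>-th power map, a ring endomorphism modulo \<open>p\<close> that fixes the integers, and let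
\<open>w \<sigma> = \<Sum>i. \<sigma> b\<^sub>i \<cdot> \<phi> c\<^sub>i\<close>. Since \<open>\<phi>\<close> applied to the trace expansion of \<open>x\<close> reads
\<open>D \<cdot> \<phi> x \<equiv> \<Sum>\<sigma>. w \<sigma> \<cdot> \<sigma> x\<close>, the case \<open>x = 1\<close> shows that some \<open>w \<sigma>\<close> is not in \<open>P\<close>. For such a
\<open>\<sigma>\<close> the two trace expansions express \<open>D \<cdot> \<sigma> x \<cdot> w \<sigma>\<close> and \<open>D \<cdot> \<phi> x \<cdot> w \<sigma>\<close> by the same double
sum \<open>\<Sum>i j. Tr (x b\<^sub>i c\<^sub>j) \<cdot> \<sigma> b\<^sub>j \<cdot> \<phi> c\<^sub>i\<close>, so that \<open>\<sigma> x \<equiv> \<phi> x\<close> after cancellation.\<close>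

lemma frobenius_exists:
  obtains \<sigma> where "\<sigma> \<in> galois_group" "\<And>x. algebraic_int x \<Longrightarrow> \<sigma> x - x ^ p \<in> P"
proof -
  have int_power: "algebraic_int (x ^ k)" if "algebraic_int x" for x :: 'k and k
    using integers.power_mem[of x k] that by simp
  have "\<exists>t. trace x = of_int t" if "algebraic_int x" for x
    using trace_int[OF that] by blast
  then obtain t where t: "\<And>x. algebraic_int x \<Longrightarrow> trace x = of_int (t x)" by metis
  have expand: "cong_int p (\<Sum>i<n. trace (x * b i) * c i ^ p) ((of_int D * x) ^ p)"
    if x: "algebraic_int x" for x
  proof -
    have xb: "algebraic_int (x * b i)" for i using x b_int by (rule algebraic_int_mult)
    have fermat: "cong_int p (\<Sum>i<n. trace (x * b i) ^ p * c i ^ p) (\<Sum>i<n. trace (x * b i) * c i ^ p)"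
      using integers.of_int_power_cong[OF prime_p] c_int
      by (intro integers.cong_sum integers.cong_mult integers.cong_refl)
        (auto simp: t[OF xb] int_power)
    have "cong_int p ((\<Sum>i<n. trace (x * b i) * c i) ^ p)
        (\<Sum>i<n. (trace (x * b i) * c i) ^ p)"
      using c_int by (intro integers.power_sum_cong prime_p) (auto simp: t[OF xb] intro: algebraic_int_mult)
    then have "cong_int p ((of_int D * x) ^ p) (\<Sum>i<n. trace (x * b i) ^ p * c i ^ p)"
      unfolding trace_expansion power_mult_distrib[of "trace _"] .
    then show ?thesis
      by (rule integers.cong_sym[OF integers.cong_trans[OF _ fermat]])
  qed
  define w where "w \<sigma> = (\<Sum>i<n. \<sigma> (b i) * c i ^ p)" for \<sigma> :: "'k \<Rightarrow> 'k"
  have w_int: "algebraic_int (w \<sigma>)" if "\<sigma> \<in> galois_group" for \<sigma>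
    using integers.sum_mem[of "{..<n}" "\<lambda>i. \<sigma> (b i) * c i ^ p"] that
    by (simp add: w_def algebraic_int_mult algebraic_int_galois b_int c_int int_power)
  have "\<exists>\<sigma>\<in>galois_group. w \<sigma> \<notin> P"
  proof (rule ccontr)
    assume "\<not> ?thesis"
    then have "(\<Sum>\<sigma>\<in>galois_group. w \<sigma>) \<in> P" by (intro P_sum) blast
    also have "(\<Sum>\<sigma>\<in>galois_group. w \<sigma>) = (\<Sum>i<n. trace (1 * b i) * c i ^ p)"
      unfolding w_def trace_def by (subst sum.swap) (simp add: sum_distrib_right)
    finally have "of_int D ^ p \<in> P"
      using cong_mem[OF integers.cong_sym[OF expand[of 1]]] by simp
    then show False using P_power[of "of_int D" p] D_notin by simp
  qed
  then obtain \<sigma> where \<sigma>: "\<sigma> \<in> galois_group" "w \<sigma> \<notin> P" by blast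
  have "\<sigma> x - x ^ p \<in> P" if x: "algebraic_int x" for x
  proof -
    have "of_int D * \<sigma> x * w \<sigma> = (\<Sum>i<n. \<sigma> (of_int D * (x * b i)) * c i ^ p)"
      by (simp add: w_def sum_distrib_left galois_mult galois_of_int \<sigma> mult.assoc)
    also have "\<dots> = (\<Sum>i<n. \<Sum>j<n. trace (x * b i * c j) * \<sigma> (b j) * c i ^ p)"
    proof (intro sum.cong refl)
      fix i
      have xb: "algebraic_int (x * b i * c j)" for j
        using x b_int c_int by (intro algebraic_int_mult)
      show "\<sigma> (of_int D * (x * b i)) * c i ^ p = (\<Sum>j<n. trace (x * b i * c j) * \<sigma> (b j) * c i ^ p)"
        unfolding trace_expansion'[symmetric]
        by (simp add: t[OF xb] galois_sum galois_mult galois_of_int \<sigma> sum_distrib_right)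
    qed
    also have "\<dots> = (\<Sum>j<n. \<sigma> (b j) * (\<Sum>i<n. trace (x * c j * b i) * c i ^ p))"
      by (subst sum.swap) (simp add: sum_distrib_left mult_ac)
    finally have "cong_int p (of_int D * \<sigma> x * w \<sigma>) (\<Sum>j<n. \<sigma> (b j) * (of_int D * (x * c j)) ^ p)"
      using \<sigma>(1) x b_int c_int
      by (simp only:) (intro integers.cong_sum integers.cong_mult integers.cong_refl expand,
        auto intro!: algebraic_int_mult int_power algebraic_int_galois[OF \<sigma>(1)])
    also have "(\<Sum>j<n. \<sigma> (b j) * (of_int D * (x * c j)) ^ p) = of_int D ^ p * (x ^ p * w \<sigma>)"
      by (simp add: w_def sum_distrib_left power_mult_distrib mult_ac)
    finally have "cong_int p (of_int D * \<sigma> x * w \<sigma>) (of_int D ^ p * (x ^ p * w \<sigma>))" .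
    moreover have "cong_int p (of_int D ^ p * (x ^ p * w \<sigma>)) (of_int D * (x ^ p * w \<sigma>))"
      using x w_int[OF \<sigma>(1)]
      by (intro integers.cong_mult integers.of_int_power_cong prime_p integers.cong_refl)
        (auto intro!: algebraic_int_mult int_power)
    ultimately have "cong_int p (of_int D * \<sigma> x * w \<sigma>) (of_int D * (x ^ p * w \<sigma>))"
      by (rule integers.cong_trans)
    then have "cong_int p (of_int D * w \<sigma> * (\<sigma> x - x ^ p)) 0"
      by (simp add: cong_modulo_def algebra_simps)
    then have "of_int D * w \<sigma> * (\<sigma> x - x ^ p) \<in> P"
      by (rule cong_mem[OF _ P_zero])
    moreover have "algebraic_int (\<sigma> x - x ^ p)"
      using integers.diff_mem[of "\<sigma> x" "x ^ p"] x by (simp add: int_power algebraic_int_galois \<sigma>)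
    ultimately show ?thesis
      using \<sigma> D_notin P_prime[of "of_int D" "w \<sigma>"] P_prime[of "of_int D * w \<sigma>" "\<sigma> x - x ^ p"]
        w_int[OF \<sigma>(1)] by (auto intro: algebraic_int_mult)
  qed
  then show ?thesis using that \<sigma>(1) by blast
qed

lemma frobenius_galois: "frobenius P \<in> galois_group"
  and frobenius_cong: "\<And>x. algebraic_int x \<Longrightarrow> frobenius P x - x ^ p \<in> P"
proof -
  have "\<exists>!\<tau>. \<tau> \<in> galois_group \<and> (\<forall>x\<in>carrier \<O>. \<tau> x - x ^ prime_below P \<in> P)"
  proof (rule ex_ex1I)
    show "\<exists>\<tau>. \<tau> \<in> galois_group \<and> (\<forall>x\<in>carrier \<O>. \<tau> x - x ^ prime_below P \<in> P)"
      using frobenius_exists by (auto simp: p_def ring_of_integers_def)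
    fix \<sigma> \<tau> :: "'k \<Rightarrow> 'k"
    assume *: "\<sigma> \<in> galois_group \<and> (\<forall>x\<in>carrier \<O>. \<sigma> x - x ^ prime_below P \<in> P)"
      "\<tau> \<in> galois_group \<and> (\<forall>x\<in>carrier \<O>. \<tau> x - x ^ prime_below P \<in> P)"
    show "\<sigma> = \<tau>"
    proof (rule frobenius_unique)
      fix x :: 'k assume "algebraic_int x"
      then show "\<sigma> x - \<tau> x \<in> P"
        using * P_diff[of "\<sigma> x - x ^ prime_below P" "\<tau> x - x ^ prime_below P"]
        by (simp add: ring_of_integers_def)
    qed (use * in auto)
  qed
  from theI'[OF this, folded frobenius_def]
  show "frobenius P \<in> galois_group" "\<And>x. algebraic_int x \<Longrightarrow> frobenius P x - x ^ p \<in> P"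
    by (auto simp: p_def ring_of_integers_def)
qed

text \<open>The annihilator of \<open>annihilator_mod_p\<close> is a unit of the localization.\<close>

lemma P_subset_p_localization:
  assumes "q \<in> P" "algebraic_int d" "d \<notin> P"
  shows "q / d \<in> (\<lambda>z. of_nat p * z) ` localization P"
proof -
  obtain y where y: "algebraic_int y" "y \<notin> P" "\<And>x. x \<in> P \<Longrightarrow> cong_int p (y * x) 0"
    by (rule annihilator_mod_p) blast
  obtain z where z: "algebraic_int z" "y * q = of_nat p * z"
    using y(3)[OF assms(1)] by (auto elim!: integers.cong_moduloE)
  have "y \<noteq> 0" "d \<noteq> 0" using y assms P_zero by auto
  then have "q / d = (y * q) / (y * d)" by simp
  also have "\<dots> = of_nat p * (z / (y * d))" unfolding z(2) by simp
  finally have "q / d = of_nat p * (z / (y * d))" .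
  moreover have "z / (y * d) \<in> localization P"
    using z(1) y(1,2) assms P_prime[of y d] by (intro localizationI algebraic_int_mult) auto
  ultimately show ?thesis by blast
qed

text \<open>For a fraction \<open>a / d\<close> the difference of both sides has the denominator \<open>d\<^sup>p \<cdot> \<tau> d\<close>, which is outside
\<open>P\<close>, and a numerator in \<open>P\<close>.\<close>

lemma frobenius_cong_localization:
  assumes "x \<in> localization P"
  shows "cong_modulo (localization P) p (x ^ p) (frobenius P x)"
proof -
  let ?\<tau> = "frobenius P"
  obtain a d where ad: "x = a / d" "algebraic_int a" "algebraic_int d" "d \<notin> P"
    using assms by (elim localizationE)
  have int: "algebraic_int (?\<tau> a)" "algebraic_int (?\<tau> d)" "algebraic_int (a ^ p)" "algebraic_int (d ^ p)"
    using ad algebraic_int_galois[OF frobenius_galois] integers.power_mem[of a p] integers.power_mem[of d p]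
    by auto
  have "d ^ p \<notin> P" using ad P_power by blast
  have "?\<tau> d \<notin> P"
    using P_diff[OF _ frobenius_cong[OF ad(3)], of "?\<tau> d"] \<open>d ^ p \<notin> P\<close> by auto
  have nz: "d ^ p \<noteq> 0" "?\<tau> d \<noteq> 0" using \<open>d ^ p \<notin> P\<close> \<open>?\<tau> d \<notin> P\<close> P_zero by metis+
  let ?q = "(?\<tau> d - d ^ p) * ?\<tau> a - (?\<tau> a - a ^ p) * ?\<tau> d"
  have "x ^ p - ?\<tau> x = ?q / (d ^ p * ?\<tau> d)"
    using nz by (simp add: ad(1) galois_divide[OF frobenius_galois] power_divide field_simps)
  moreover have "?q \<in> P"
    by (intro P_diff P_mult frobenius_cong ad int)
  moreover have "algebraic_int (d ^ p * ?\<tau> d)" "d ^ p * ?\<tau> d \<notin> P"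
    using int P_prime[of "d ^ p" "?\<tau> d"] \<open>d ^ p \<notin> P\<close> \<open>?\<tau> d \<notin> P\<close> by (auto intro: algebraic_int_mult)
  ultimately show ?thesis
    unfolding cong_modulo_def using P_subset_p_localization by metis
qed

end

section \<open>Cartier congruences for constant terms of traces\<close>

lemma (in galois_number_field) common_denominator_set:
  assumes "finite (X :: 'k set)"
  obtains N :: int where "N \<noteq> 0" "\<And>x. x \<in> X \<Longrightarrow> algebraic_int (of_int N * x)"
proof -
  have "\<exists>N::int. N \<noteq> 0 \<and> algebraic_int (of_int N * x)" for x :: 'k
    using number_field_common_denominator[of x] number_field by (auto simp: number_field_def)
  then obtain N :: "'k \<Rightarrow> int" where N: "\<And>x. N x \<noteq> 0" "\<And>x. algebraic_int (of_int (N x) * x)"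
    by metis
  show ?thesis
  proof
    show "prod N X \<noteq> 0" using assms N(1) by simp
    fix x assume "x \<in> X"
    then have "of_int (prod N X) * x = of_int (\<Prod>z\<in>X - {x}. N z) * (of_int (N x) * x)"
      by (simp add: prod.remove[OF assms] mult_ac)
    then show "algebraic_int (of_int (prod N X) * x)"
      using N(2)[of x] algebraic_int_mult[OF algebraic_int_of_int] by metis
  qed
qed

context good_prime
begin

text \<open>The Frobenius element may be applied to every diagonal entry separately because it is additive.\<close>

lemma cartier_congruences_cst_trace:
  fixes A :: "('r, 'k) laurent_poly mat"
  assumes A: "A \<in> carrier_mat d d"
    and coeff: "\<And>i j v. i < d \<Longrightarrow> j < d \<Longrightarrow> Poly_Mapping.lookup (A $$ (i, j)) v \<in> localization P"
  shows "cartier_congruences (extend_by_zero (\<lambda>n. cst (mat_trace (A ^\<^sub>m n)))) P"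
proof -
  let ?a = "\<lambda>n. cst (mat_trace (A ^\<^sub>m n))"
  interpret loc: unital_subring "localization P" by (rule unital_subring_localization)
  interpret laurent: unital_subring "loc.laurent_over :: ('r, 'k) laurent_poly set"
    by (rule loc.unital_subring_laurent_over)
  have step: "cong_modulo (localization P) p (?a (n * p)) (frobenius P (?a n))" for n
  proof -
    let ?B = "A ^\<^sub>m n"
    have B: "?B \<in> carrier_mat d d" using A by (rule pow_carrier_mat)
    have B_mem: "?B $$ (i, j) \<in> loc.laurent_over" if "i < d" "j < d" for i j
      using coeff that by (intro laurent.pow_mat_mem[OF A]) (auto simp: loc.laurent_over_def)
    have "?a (n * p) = cst (mat_trace (?B ^\<^sub>m p))"
      using pow_mat_mult_exp[OF A] by simp
    also have "cong_modulo (localization P) p \<dots> (\<Sum>i<d. cst (?B $$ (i, i)) ^ p)"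
      by (rule loc.cst_trace_power_cong[OF prime_p B B_mem])
    also have "cong_modulo (localization P) p \<dots> (\<Sum>i<d. frobenius P (cst (?B $$ (i, i))))"
      using B_mem
      by (intro loc.cong_sum frobenius_cong_localization) (simp add: loc.laurent_over_def cst_def)
    also have "(\<Sum>i<d. frobenius P (cst (?B $$ (i, i)))) = frobenius P (?a n)"
      using A B by (simp add: mat_trace_def cst_def lookup_sum galois_sum[OF frobenius_galois])
    finally show ?thesis .
  qed
  have "p > 0" using prime_p by (rule prime_gt_0_nat)
  have "cong_modulo (localization P) p (extend_by_zero ?a (m * int p)) (frobenius P (extend_by_zero ?a m))" for m
  proof (cases "m < 0")
    case True
    then have "m * int p < 0" using \<open>p > 0\<close> by (simp add: mult_neg_pos)
    then show ?thesis
      using True by (simp add: extend_by_zero_def galois_0[OF frobenius_galois] loc.cong_refl)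
  next
    case False
    then have "nat (m * int p) = nat m * p" "\<not> m * int p < 0"
      by (simp_all add: nat_mult_distrib not_less)
    then show ?thesis using step[of "nat m"] False by (simp add: extend_by_zero_def)
  qed
  then show ?thesis
    unfolding cartier_congruences_def cong_modulo_def p_def by blast
qed

end

theorem proposition2:
  fixes A :: "('r::finite, 'k::field_char_0) laurent_poly mat"
  assumes "number_field TYPE('k)"
    and "galois_over_rationals TYPE('k)"
    and "A \<in> carrier_mat d d"
  shows "cartier_property (extend_by_zero (\<lambda>n. cst (mat_trace (A ^\<^sub>m n))))"
proof -
  interpret galois_number_field "TYPE('k)" using assms(1,2) by unfold_locales
  obtain D n and b c :: "nat \<Rightarrow> 'k" where sep: "separating_family TYPE('k) D n b c"
    by (rule separating_family_exists)
  interpret separating_family "TYPE('k)" D n b c by (rule sep)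
  define X where "X = (\<Union>i\<in>{..<d}. \<Union>j\<in>{..<d}. Poly_Mapping.lookup (A $$ (i, j)) ` Poly_Mapping.keys (A $$ (i, j)))"
  have "finite X" unfolding X_def by auto
  then obtain N where N: "N \<noteq> 0" "\<And>x. x \<in> X \<Longrightarrow> algebraic_int (of_int N * x)"
    by (rule common_denominator_set) blast
  have "unramified P \<and> cartier_congruences (extend_by_zero (\<lambda>n. cst (mat_trace (A ^\<^sub>m n)))) P"
    if P: "nonzero_prime P" and DN: "of_int (D * N) \<notin> P" for P
  proof -
    interpret prime_over P "TYPE('k)" using P by unfold_locales
    have notin: "of_int D \<notin> P" "of_int N \<notin> P"
      using DN P_mult[of "of_int D" "of_int N"] P_mult[of "of_int N" "of_int D"]
      by (auto simp: mult.commute)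
    interpret good_prime P "TYPE('k)" D n b c using notin by unfold_locales
    have "Poly_Mapping.lookup (A $$ (i, j)) v \<in> localization P" if "i < d" "j < d" for i j v
    proof (cases "v \<in> Poly_Mapping.keys (A $$ (i, j))")
      case True
      let ?x = "Poly_Mapping.lookup (A $$ (i, j)) v"
      have "?x \<in> X" using that True by (auto simp: X_def)
      then have "of_int N * ?x / of_int N \<in> localization P"
        using notin N(2) by (intro localizationI) auto
      then show ?thesis using N(1) by simp
    next
      case False
      then show ?thesis
        using unital_subring.zero_mem[OF unital_subring_localization] by (simp add: in_keys_iff)
    qed
    then show ?thesis
      using unramified cartier_congruences_cst_trace[OF assms(3)] by blast
  qed
  then have "{P. nonzero_prime P \<and> \<not> (unramified P \<and>
        cartier_congruences (extend_by_zero (\<lambda>n. cst (mat_trace (A ^\<^sub>m n)))) P)}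
      \<subseteq> {P. nonzero_prime P \<and> of_int (D * N) \<in> P}"
    by blast
  then show ?thesis
    unfolding cartier_property_def
    using finite_primes_containing[of "D * N"] D N(1) by (auto intro: finite_subset)
qed

end
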